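(* Let $n\in\mathbb{Z}$, $n\neq 0$, and $\theta,\theta'\in\Theta=\nu\,\mathbb{C}[[\nu]]$. Let $U(x,y,t)=e^{2\pi i y}$ and $V(x,y,t)=e^{2\pi i x}$, which are elements of $A_0=C^\infty(\mathbb{T}^2)$. Define, for $\widetilde f\in\widetilde E_n$ (corresponding to $f\in E_n$) and $a\in A_0$, $a.\widetilde f:=\widetilde{a\ast_{\theta'}f}$ and $\widetilde f.a:=\widetilde{f\ast_\theta a}$. Then for all $\widetilde f\in\widetilde E_n$: $$(U.\widetilde f)(x;k)=\widetilde f\big(x-\tfrac1n;k-1\big),\qquad (\widetilde f.U)(x;k)=\widetilde f\big(x-\tfrac1n-\theta;k-1\big),$$ $$(V.\widetilde f)(x;k)=e^{2\pi i(x-\frac kn)}e^{-2\pi i n\theta' x}\,\widetilde f(x;k),\qquad (\widetilde f.V)(x;k)=e^{2\pi i(x-\frac kn)}\,\widetilde f(x;k).$$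
   Context: Let $A=\{f\in C^\infty(\mathbb{R}\times\mathbb{T}^2): f(x+1,y,t+y)=f(x,y,t)\}$, with coordinates $x\in\mathbb{R}$ and $(y,t)\in\mathbb{T}^2=\mathbb{R}^2/\mathbb{Z}^2$, and pointwise multiplication (smooth functions on the 3-dimensional Heisenberg manifold). The Heisenberg Lie algebra with basis $\mathfrak{p},\mathfrak{q},\mathfrak{t}$, $\mathfrak{t}$ central, $[\mathfrak{p},\mathfrak{q}]=\mathfrak{t}$, acts on $A$ by the derivations $$\mathfrak{p}=\tfrac{1}{\sqrt{2\pi}}\tfrac{\partial}{\partial x},\qquad \mathfrak{q}=\tfrac{-i}{\sqrt{2\pi}}\Big(\tfrac{\partial}{\partial y}+x\tfrac{\partial}{\partial t}\Big),\qquad \mathfrak{t}=\tfrac{1}{2\pi i}\tfrac{\partial}{\partial t}.$$ Put $A_n:=\{f\in A:\mathfrak{t}f=nf\}$ and $E_n:=A_n[[\nu]]$; $A_0$ is identified with $C^\infty(\mathbb{T}^2)$, functions of $(x,y)$ periodic with period 1 in each variable. For $\theta\in\Theta:=\nu\,\mathbb{C}[[\nu]]$ the product on $A[[\nu]]$ is $a\ast_\theta b:=\sum_{j\ge 0}\frac{(-\theta)^j}{j!}(\mathfrak{p}^ja)(\mathfrak{q}^jb)$, extended $\mathbb{C}[[\nu]]$-bilinearly. For $n\ne0$ it is known (Weil–Brezin–Zak transform) that every $f\in A_n$ can be written as $$f(x,y,t)=\sum_{k\in\mathbb{Z}}\widetilde f\big(x+\tfrac kn;k\big)e^{2\pi i(ky+nt)}$$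 for a unique Schwartz function $\widetilde f\in\mathcal{S}(\mathbb{R}\times\mathbb{Z}/n\mathbb{Z})$ (a function of $x\in\mathbb{R}$ and $k\in\mathbb{Z}$, $n$-periodic in $k$ and Schwartz in $x$), and that $f\mapsto\widetilde f$ is a bijection $A_n\to\mathcal{S}(\mathbb{R}\times\mathbb{Z}/n\mathbb{Z})$; extend it $\mathbb{C}[[\nu]]$-linearly to a bijection $E_n\to\widetilde E_n:=\mathcal{S}(\mathbb{R}\times\mathbb{Z}/n\mathbb{Z})[[\nu]]$. For a smooth function $\psi$ and $\theta\in\Theta$, $\psi(x+\theta)$ denotes the formal power series $\sum_{j\ge0}\frac{\theta^j}{j!}\psi^{(j)}(x)$, and $e^{-2\pi i n\theta'x}$ denotes the formal exponential series in $\theta'$. *)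

theory Defs
  imports "HOL-Analysis.Analysis" "HOL-Computational_Algebra.Formal_Power_Series"
begin

section \<open>Smooth functions\<close>

primrec Ck :: "nat \<Rightarrow> ('a::real_normed_vector \<Rightarrow> 'b::real_normed_vector) \<Rightarrow> bool" where
  "Ck 0 f \<longleftrightarrow> continuous_on UNIV f"
| "Ck (Suc k) f \<longleftrightarrow>
     (\<forall>x. f differentiable (at x)) \<and> (\<forall>v. Ck k (\<lambda>x. frechet_derivative f (at x) v))"

definition smooth :: "('a::real_normed_vector \<Rightarrow> 'b::real_normed_vector) \<Rightarrow> bool" where
  "smooth f \<longleftrightarrow> (\<forall>k. Ck k f)"


section \<open>Functions on the Heisenberg manifold\<close>

text \<open>Points \<open>(x, y, t)\<close>; a function on \<open>\<real> \<times> \<real>\<^sup>2/\<int>\<^sup>2\<close> is a function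
  on \<open>\<real>\<^sup>3\<close> of period 1 in \<open>y\<close> and in \<open>t\<close>.\<close>

type_synonym point = "real \<times> real \<times> real"

definition partial_x :: "(point \<Rightarrow> complex) \<Rightarrow> point \<Rightarrow> complex" where
  "partial_x f = (\<lambda>(x, y, t). vector_derivative (\<lambda>s. f (s, y, t)) (at x))"

definition partial_y :: "(point \<Rightarrow> complex) \<Rightarrow> point \<Rightarrow> complex" where
  "partial_y f = (\<lambda>(x, y, t). vector_derivative (\<lambda>s. f (x, s, t)) (at y))"

definition partial_t :: "(point \<Rightarrow> complex) \<Rightarrow> point \<Rightarrow> complex" where
  "partial_t f = (\<lambda>(x, y, t). vector_derivative (\<lambda>s. f (x, y, s)) (at t))"

definition heis_p :: "(point \<Rightarrow> complex) \<Rightarrow> point \<Rightarrow> complex" where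
  "heis_p f = (\<lambda>(x, y, t). 1 / of_real (sqrt (2 * pi)) * partial_x f (x, y, t))"

definition heis_q :: "(point \<Rightarrow> complex) \<Rightarrow> point \<Rightarrow> complex" where
  "heis_q f = (\<lambda>(x, y, t). - \<i> / of_real (sqrt (2 * pi)) *
     (partial_y f (x, y, t) + of_real x * partial_t f (x, y, t)))"

definition heis_t :: "(point \<Rightarrow> complex) \<Rightarrow> point \<Rightarrow> complex" where
  "heis_t f = (\<lambda>(x, y, t). 1 / (2 * of_real pi * \<i>) * partial_t f (x, y, t))"

definition heis_alg :: "(point \<Rightarrow> complex) set" where
  "heis_alg = {f. smooth f \<and>
     (\<forall>x y t. f (x, y + 1, t) = f (x, y, t)) \<and>
     (\<forall>x y t. f (x, y, t + 1) = f (x, y, t)) \<and>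
     (\<forall>x y t. f (x + 1, y, t + y) = f (x, y, t))}"

definition heis_eig :: "int \<Rightarrow> (point \<Rightarrow> complex) set" where
  "heis_eig n = {f \<in> heis_alg. \<forall>p. heis_t f p = of_int n * f p}"

definition torus_U :: "point \<Rightarrow> complex" where
  "torus_U = (\<lambda>(x, y, t). exp (2 * of_real pi * \<i> * of_real y))"

definition torus_V :: "point \<Rightarrow> complex" where
  "torus_V = (\<lambda>(x, y, t). exp (2 * of_real pi * \<i> * of_real x))"


section \<open>Formal power series with coefficients in a space of functions\<close>

text \<open>A formal power series \<open>\<Sum>\<^sub>N f\<^sub>N \<nu>\<^sup>N\<close> of functions \<open>f\<^sub>N\<close> is encoded as the function
  \<open>p \<mapsto> \<Sum>\<^sub>N f\<^sub>N(p) \<nu>\<^sup>N\<close> with values in \<open>\<complex>[[\<nu>]]\<close>.  With this encoding, products and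
  \<open>\<complex>[[\<nu>]]\<close>-multiples of such series are formed pointwise.  Infinite sums in
  \<open>\<complex>[[\<nu>]]\<close> are taken in the \<open>\<nu>\<close>-adic topology, the topology of the type
  \<open>complex fps\<close>.\<close>

definition fcoeff :: "('a \<Rightarrow> complex fps) \<Rightarrow> nat \<Rightarrow> 'a \<Rightarrow> complex" where
  "fcoeff F N = (\<lambda>p. fps_nth (F p) N)"

definition series_over :: "('a \<Rightarrow> complex) set \<Rightarrow> ('a \<Rightarrow> complex fps) set" where
  "series_over S = {F. \<forall>N. fcoeff F N \<in> S}"

definition fconst :: "('a \<Rightarrow> complex) \<Rightarrow> 'a \<Rightarrow> complex fps" where
  "fconst a = (\<lambda>p. fps_const (a p))"

text \<open>Coefficientwise extension of an operator; for a linear operator this is its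
  \<open>\<complex>[[\<nu>]]\<close>-linear extension.\<close>

definition coeffwise ::
  "(('a \<Rightarrow> complex) \<Rightarrow> ('b \<Rightarrow> complex)) \<Rightarrow> ('a \<Rightarrow> complex fps) \<Rightarrow> ('b \<Rightarrow> complex fps)" where
  "coeffwise D F = (\<lambda>p. Abs_fps (\<lambda>N. D (fcoeff F N) p))"

definition Theta :: "complex fps set" where
  "Theta = {\<theta>. fps_nth \<theta> 0 = 0}"

definition star ::
  "complex fps \<Rightarrow> (point \<Rightarrow> complex fps) \<Rightarrow> (point \<Rightarrow> complex fps) \<Rightarrow> point \<Rightarrow> complex fps" where
  "star \<theta> F G = (\<lambda>p. \<Sum>j. fps_const (1 / fact j) * (- \<theta>) ^ j *
     coeffwise (heis_p ^^ j) F p * coeffwise (heis_q ^^ j) G p)"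


section \<open>The Weil--Brezin--Zak transform\<close>

definition schwartz :: "(real \<Rightarrow> complex) set" where
  "schwartz = {g. smooth g \<and>
     (\<forall>a b. bounded (range (\<lambda>x. of_real (x ^ a) *
        (((\<lambda>h x. vector_derivative h (at x)) ^^ b) g) x)))}"

text \<open>\<open>\<S>(\<real> \<times> \<int>/n\<int>)\<close>, as functions of \<open>x \<in> \<real>\<close> and \<open>k \<in> \<int>\<close>, \<open>n\<close>-periodic in \<open>k\<close>.\<close>

definition schwartz_mod :: "int \<Rightarrow> (real \<times> int \<Rightarrow> complex) set" where
  "schwartz_mod n = {g. (\<forall>x k. g (x, k + n) = g (x, k)) \<and> (\<forall>k. (\<lambda>x. g (x, k)) \<in> schwartz)}"

definition wbz_sum :: "int \<Rightarrow> (real \<times> int \<Rightarrow> complex) \<Rightarrow> point \<Rightarrow> complex" where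
  "wbz_sum n g = (\<lambda>(x, y, t). \<Sum>\<^sub>\<infinity>k\<in>UNIV. g (x + of_int k / of_int n, k) *
     exp (2 * of_real pi * \<i> * (of_int k * of_real y + of_int n * of_real t)))"

text \<open>The transform is a map with domain \<open>heis_eig n\<close>, hence left unspecified outside of it.\<close>

definition wbz :: "int \<Rightarrow> (point \<Rightarrow> complex) \<Rightarrow> (real \<times> int \<Rightarrow> complex)" where
  "wbz n = (\<lambda>f\<in>heis_eig n. THE g. g \<in> schwartz_mod n \<and> f = wbz_sum n g)"

text \<open>Since \<open>wbz_sum n\<close> is the inverse of the transform, \<open>coeffwise (wbz_sum n) F\<close> is the
  series \<open>f\<close> over \<open>heis_eig n\<close> corresponding to a series \<open>F\<close> over \<open>schwartz_mod n\<close>.\<close>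

definition left_act ::
  "int \<Rightarrow> complex fps \<Rightarrow> (point \<Rightarrow> complex) \<Rightarrow> (real \<times> int \<Rightarrow> complex fps) \<Rightarrow> (real \<times> int \<Rightarrow> complex fps)"
  where "left_act n \<theta> a F = coeffwise (wbz n) (star \<theta> (fconst a) (coeffwise (wbz_sum n) F))"

definition right_act ::
  "int \<Rightarrow> complex fps \<Rightarrow> (real \<times> int \<Rightarrow> complex fps) \<Rightarrow> (point \<Rightarrow> complex) \<Rightarrow> (real \<times> int \<Rightarrow> complex fps)"
  where "right_act n \<theta> F a = coeffwise (wbz n) (star \<theta> (coeffwise (wbz_sum n) F) (fconst a))"

text \<open>\<open>formal_shift \<theta> \<psi> x\<close> is \<open>\<psi>(x + \<theta>)\<close>, the formal Taylor series.\<close>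

definition formal_shift :: "complex fps \<Rightarrow> (real \<Rightarrow> complex fps) \<Rightarrow> real \<Rightarrow> complex fps" where
  "formal_shift \<theta> \<psi> x = (\<Sum>j. fps_const (1 / fact j) * \<theta> ^ j *
     coeffwise ((\<lambda>h x. vector_derivative h (at x)) ^^ j) \<psi> x)"

text \<open>The formal exponential series \<open>e\<^sup>c\<^sup>\<theta> = \<Sum>\<^sub>j (c\<theta>)\<^sup>j / j!\<close>.\<close>

definition formal_exp :: "complex \<Rightarrow> complex fps \<Rightarrow> complex fps" where
  "formal_exp c \<theta> = fps_exp c oo \<theta>"

end

theory Submission
  imports Defs
begin

text \<open>On transforms, \<open>heis_p\<close> acts as \<open>1/\<surd>(2\<pi>)\<close> times \<open>d/dx\<close> and \<open>heis_q\<close> as multiplication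
  by \<open>\<surd>(2\<pi>) n x\<close>, while multiplication by \<open>U\<close> is a translation and multiplication by \<open>V\<close> is
  multiplication by \<open>e(x - k/n)\<close>.  Moreover \<open>U\<close> is killed by \<open>heis_p\<close> and is an eigenvector of
  \<open>heis_q\<close>, and vice versa for \<open>V\<close>.  Hence each star product either collapses to its term
  \<open>j = 0\<close> or becomes a Taylor or an exponential series.  To transform back one needs that the
  Zak series of a Schwartz function lies in \<open>heis_eig n\<close>, by termwise differentiation, and
  determines that function, by uniqueness of Fourier coefficients in \<open>y\<close>.\<close>

section \<open>Smooth and Schwartz functions of one variable\<close>

text \<open>The transform \<open>wbz\<close> is a definite description on \<open>heis_eig n\<close>,
  so it is evaluated only on explicit values of \<open>wbz_sum\<close>: every coefficient of a star
  product has to be rewritten as \<open>wbz_sum n g\<close> with \<open>g\<close> in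
  \<open>schwartz_mod n\<close>. As \<open>\<theta>\<close> has no constant term, each coefficient
  in \<nu> involves finitely many \<open>j\<close>, and linearity of \<open>wbz_sum\<close> carries
  this out.

  The operators come from the term of index k. Up to 2 pi i, d/dy produces k and x d/dt produces n
  x, and k + n x = n (x + k/n) is n times the argument of the profile; hence \<open>heis_q\<close>
  becomes a multiplication. With s = sqrt(2 pi), U has eigenvalue s under \<open>heis_q\<close>
  while \<open>heis_p\<close> is (1/s) d/dx, so f.U is a Taylor series in - \<theta>. V has
  eigenvalue s i under \<open>heis_p\<close> while \<open>heis_q\<close> is s n x; the product 2 pi
  i n x, times - \<theta>', is the exponent in V.f.

  Differentiating in y alone brings out a factor k, which is not n-periodic, so partial derivatives
  leave the image of \<open>wbz_sum\<close>. Smoothness is therefore proved for a larger class of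
  series, closed under all directional derivatives.\<close>

lemma smooth_coinduct:
  fixes f :: "'a::real_normed_vector \<Rightarrow> 'b::real_normed_vector"
  assumes "X f"
    and diff: "\<And>f x. X f \<Longrightarrow> f differentiable (at x)"
    and deriv: "\<And>f v. X f \<Longrightarrow> X (\<lambda>x. frechet_derivative f (at x) v)"
  shows "smooth f"
proof -
  \<comment> \<open>The induction runs over all members of \<open>X\<close> at once, because its
    step passes from a function to its directional derivatives.\<close>
  have "Ck k f" if "X f" for k and f :: "'a \<Rightarrow> 'b"
    using that
  proof (induction k arbitrary: f)
    case 0
    then show ?case
      by (auto intro!: differentiable_imp_continuous_on diff simp: differentiable_on_def)
  next
    case (Suc k)
    then show ?case using diff deriv by auto
  qed
  with \<open>X f\<close> show ?thesis by (simp add: smooth_def)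
qed

text \<open>On the real line the derivative in direction v is v times the ordinary one. Closure of
  \<open>X\<close> under ordinary derivatives is thus enough: the real multiples are adjoined inside
  the proof.\<close>

lemma smooth_real_coinduct:
  fixes f :: "real \<Rightarrow> 'b::real_normed_vector"
  assumes "X f"
    and X: "\<And>f. X f \<Longrightarrow> \<exists>f'. X f' \<and> (\<forall>x. (f has_vector_derivative f' x) (at x))"
  shows "smooth f"
proof (rule smooth_coinduct[where X = "\<lambda>f. \<exists>c h. X h \<and> f = (\<lambda>x. c *\<^sub>R h x)"])
  show "\<exists>c h. X h \<and> f = (\<lambda>x. c *\<^sub>R h x)"
    using \<open>X f\<close> by (intro exI[of _ 1] exI[of _ f]) auto
next
  fix f :: "real \<Rightarrow> 'b" and x
  assume "\<exists>c h. X h \<and> f = (\<lambda>x. c *\<^sub>R h x)"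
  then obtain c h where h: "X h" "f = (\<lambda>x. c *\<^sub>R h x)" by auto
  obtain h' where "\<And>x. (h has_vector_derivative h' x) (at x)" using X h by blast
  hence "(f has_vector_derivative c *\<^sub>R h' x) (at x)"
    unfolding h by (auto intro!: derivative_eq_intros)
  thus "f differentiable (at x)" by (auto simp: has_vector_derivative_def differentiable_def)
next
  fix f :: "real \<Rightarrow> 'b" and v
  assume "\<exists>c h. X h \<and> f = (\<lambda>x. c *\<^sub>R h x)"
  then obtain c h where h: "X h" "f = (\<lambda>x. c *\<^sub>R h x)" by auto
  obtain h' where h': "X h'" "\<And>x. (h has_vector_derivative h' x) (at x)" using X h by blast
  have "(f has_derivative (\<lambda>v. v *\<^sub>R (c *\<^sub>R h' x))) (at x)" for x
    unfolding h has_vector_derivative_def[symmetric] using h' by (auto intro!: derivative_eq_intros)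
  hence "frechet_derivative f (at x) = (\<lambda>v. v *\<^sub>R (c *\<^sub>R h' x))" for x
    using frechet_derivative_at by metis
  hence "(\<lambda>x. frechet_derivative f (at x) v) = (\<lambda>x. (v * c) *\<^sub>R h' x)"
    by simp
  with h' show "\<exists>c h. X h \<and> (\<lambda>x. frechet_derivative f (at x) v) = (\<lambda>x. c *\<^sub>R h x)"
    by blast
qed

abbreviation vderiv :: "(real \<Rightarrow> 'b::real_normed_vector) \<Rightarrow> real \<Rightarrow> 'b"
  where "vderiv \<equiv> (\<lambda>h x. vector_derivative h (at x))"

lemma smooth_has_vderiv:
  assumes "smooth f"
  shows "(f has_vector_derivative vderiv f x) (at x)"
proof -
  have "Ck (Suc 0) f" using assms by (simp only: smooth_def)
  thus ?thesis
    using vector_derivative_works[of f "at x"] by simp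
qed

lemma smooth_vderiv:
  fixes f :: "real \<Rightarrow> 'b::real_normed_vector"
  assumes "smooth f"
  shows "smooth (vderiv f)"
proof -
  have eq: "(\<lambda>x. frechet_derivative f (at x) 1) = vderiv f"
  proof
    fix x
    have "frechet_derivative f (at x) = (\<lambda>v. v *\<^sub>R vderiv f x)"
      using smooth_has_vderiv[OF assms, of x] unfolding has_vector_derivative_def
      by (rule frechet_derivative_at[symmetric])
    thus "frechet_derivative f (at x) 1 = vderiv f x" by simp
  qed
  have "Ck (Suc k) f" for k using assms by (simp only: smooth_def)
  hence "Ck k (\<lambda>x. frechet_derivative f (at x) 1)" for k by simp
  thus ?thesis unfolding eq by (simp add: smooth_def)
qed

text \<open>Decay is asked only of the members themselves, since their iterated derivatives are
  members again. Each closure property below then needs a suitable class \<open>X\<close> instead of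
  a Leibniz expansion of the b-th derivative.\<close>

lemma schwartz_coinduct:
  assumes "X g"
    and deriv: "\<And>g. X g \<Longrightarrow> \<exists>g'. X g' \<and> (\<forall>x. (g has_vector_derivative g' x) (at x))"
    and decay: "\<And>g a. X g \<Longrightarrow> \<exists>C. \<forall>x. \<bar>x\<bar> ^ a * cmod (g x) \<le> C"
  shows "g \<in> schwartz"
proof -
  have vd: "X (vderiv g)" if Xg: "X g" for g
  proof -
    obtain g' where g': "X g'" "\<And>x. (g has_vector_derivative g' x) (at x)" using deriv[OF Xg] by blast
    hence "vderiv g = g'" by (auto simp: vector_derivative_at)
    with g' show ?thesis by simp
  qed
  have "X ((vderiv ^^ b) g)" for b
    by (induction b) (use vd \<open>X g\<close> in auto)
  hence "\<exists>C. \<forall>x. \<bar>x\<bar> ^ a * cmod (((vderiv ^^ b) g) x) \<le> C" for a b using decay by blast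
  hence "bounded (range (\<lambda>x. of_real (x ^ a) * ((vderiv ^^ b) g) x))" for a b
    by (force simp: bounded_iff norm_mult norm_power)
  moreover have "smooth g" using \<open>X g\<close> deriv by (rule smooth_real_coinduct)
  ultimately show ?thesis by (simp add: schwartz_def)
qed

lemma schwartz_has_vderiv: "g \<in> schwartz \<Longrightarrow> (g has_vector_derivative vderiv g x) (at x)"
  by (simp add: schwartz_def smooth_has_vderiv)

lemma schwartz_vderiv:
  assumes "g \<in> schwartz"
  shows "vderiv g \<in> schwartz"
proof -
  have "bounded (range (\<lambda>x. of_real (x ^ a) * ((vderiv ^^ b) (vderiv g)) x))" for a b
  proof -
    have "bounded (range (\<lambda>x. of_real (x ^ a) * ((vderiv ^^ Suc b) g) x))"
      using assms unfolding schwartz_def by blast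
    thus ?thesis by (simp only: funpow_Suc_right o_def)
  qed
  thus ?thesis using assms smooth_vderiv by (auto simp: schwartz_def)
qed

lemma schwartz_decay:
  assumes "g \<in> schwartz"
  obtains C where "\<And>x. \<bar>x\<bar> ^ a * cmod (g x) \<le> C"
proof -
  have "bounded (range (\<lambda>x. of_real (x ^ a) * ((vderiv ^^ 0) g) x))"
    using assms unfolding schwartz_def by blast
  then obtain C where "\<And>x. cmod (of_real (x ^ a) * g x) \<le> C"
    by (auto simp: bounded_iff)
  thus ?thesis using that[of C] by (simp add: norm_mult norm_power)
qed

lemma schwartz_lincomb:
  assumes "g \<in> schwartz" "h \<in> schwartz"
  shows "(\<lambda>x. c * g x + d * h x) \<in> schwartz"
proof (rule schwartz_coinduct[where
    X = "\<lambda>f. \<exists>g h. g \<in> schwartz \<and> h \<in> schwartz \<and> f = (\<lambda>x. c * g x + d * h x)"])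
  fix f assume "\<exists>g h. g \<in> schwartz \<and> h \<in> schwartz \<and> f = (\<lambda>x. c * g x + d * h x)"
  then obtain g h where gh: "g \<in> schwartz" "h \<in> schwartz" "f = (\<lambda>x. c * g x + d * h x)" by blast
  have "(f has_vector_derivative c * vderiv g x + d * vderiv h x) (at x)" for x
    unfolding gh(3)
    by (intro has_vector_derivative_add has_vector_derivative_mult_right schwartz_has_vderiv gh)
  thus "\<exists>f'. (\<exists>g h. g \<in> schwartz \<and> h \<in> schwartz \<and> f' = (\<lambda>x. c * g x + d * h x)) \<and>
        (\<forall>x. (f has_vector_derivative f' x) (at x))"
    using schwartz_vderiv[OF gh(1)] schwartz_vderiv[OF gh(2)] by blast
  fix a
  obtain C where C: "\<And>x. \<bar>x\<bar> ^ a * cmod (g x) \<le> C" using schwartz_decay[OF gh(1)] by blast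
  obtain D where D: "\<And>x. \<bar>x\<bar> ^ a * cmod (h x) \<le> D" using schwartz_decay[OF gh(2)] by blast
  have "\<bar>x\<bar> ^ a * cmod (f x) \<le> cmod c * C + cmod d * D" for x
  proof -
    have "\<bar>x\<bar> ^ a * cmod (f x) \<le> \<bar>x\<bar> ^ a * (cmod c * cmod (g x) + cmod d * cmod (h x))"
      unfolding gh(3) by (intro mult_left_mono order.trans[OF norm_triangle_ineq]) (auto simp: norm_mult)
    also have "\<dots> = cmod c * (\<bar>x\<bar> ^ a * cmod (g x)) + cmod d * (\<bar>x\<bar> ^ a * cmod (h x))"
      by (simp add: algebra_simps)
    also have "\<dots> \<le> cmod c * C + cmod d * D"
      by (intro add_mono mult_left_mono C D) auto
    finally show ?thesis .
  qed
  thus "\<exists>C. \<forall>x. \<bar>x\<bar> ^ a * cmod (f x) \<le> C" by blast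
qed (use assms in blast)

text \<open>The functions x g alone are not closed under differentiation, as (x g)' = x g' + g. The
  class therefore carries a Schwartz summand \<open>h\<close> that absorbs the extra term.\<close>

lemma schwartz_mult_id:
  assumes "g \<in> schwartz"
  shows "(\<lambda>x. of_real x * g x) \<in> schwartz"
proof (rule schwartz_coinduct[where
    X = "\<lambda>f. \<exists>g h. g \<in> schwartz \<and> h \<in> schwartz \<and> f = (\<lambda>x. of_real x * g x + h x)"])
  have "(\<lambda>x. 0 * g x + 0 * g x) \<in> schwartz" by (intro schwartz_lincomb assms)
  hence "(\<lambda>x. 0) \<in> schwartz" by simp
  with assms show "\<exists>g' h. g' \<in> schwartz \<and> h \<in> schwartz \<and>
      (\<lambda>x. of_real x * g x) = (\<lambda>x. of_real x * g' x + h x)"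
    by (intro exI[of _ g] exI[of _ "\<lambda>x. 0"]) auto
next
  fix f assume "\<exists>g h. g \<in> schwartz \<and> h \<in> schwartz \<and> f = (\<lambda>x. of_real x * g x + h x)"
  then obtain g h where gh: "g \<in> schwartz" "h \<in> schwartz" "f = (\<lambda>x. of_real x * g x + h x)" by blast
  have "(f has_vector_derivative of_real x * vderiv g x + (1 * g x + 1 * vderiv h x)) (at x)" for x
    using has_vector_derivative_add[OF has_vector_derivative_mult[OF
        has_vector_derivative_of_real[OF DERIV_ident] schwartz_has_vderiv[OF gh(1)]]
        schwartz_has_vderiv[OF gh(2)], of x]
    unfolding gh(3) by (simp add: add_ac)
  thus "\<exists>f'. (\<exists>g h. g \<in> schwartz \<and> h \<in> schwartz \<and> f' = (\<lambda>x. of_real x * g x + h x)) \<and>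
        (\<forall>x. (f has_vector_derivative f' x) (at x))"
    using schwartz_vderiv[OF gh(1)] schwartz_lincomb[OF gh(1) schwartz_vderiv[OF gh(2)], of 1 1]
    by blast
  fix a
  obtain C where C: "\<And>x. \<bar>x\<bar> ^ Suc a * cmod (g x) \<le> C" using schwartz_decay[OF gh(1)] by blast
  obtain D where D: "\<And>x. \<bar>x\<bar> ^ a * cmod (h x) \<le> D" using schwartz_decay[OF gh(2)] by blast
  have "\<bar>x\<bar> ^ a * cmod (f x) \<le> C + D" for x
  proof -
    have "\<bar>x\<bar> ^ a * cmod (f x) \<le> \<bar>x\<bar> ^ a * (\<bar>x\<bar> * cmod (g x) + cmod (h x))"
      unfolding gh(3) by (intro mult_left_mono order.trans[OF norm_triangle_ineq]) (auto simp: norm_mult)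
    also have "\<dots> = \<bar>x\<bar> ^ Suc a * cmod (g x) + \<bar>x\<bar> ^ a * cmod (h x)"
      by (simp add: algebra_simps)
    also have "\<dots> \<le> C + D" by (intro add_mono C D)
    finally show ?thesis .
  qed
  thus "\<exists>C. \<forall>x. \<bar>x\<bar> ^ a * cmod (f x) \<le> C" by blast
qed

lemma schwartz_mult_exp:
  assumes "g \<in> schwartz"
  shows "(\<lambda>x. exp (2 * of_real pi * \<i> * (of_real x - c)) * g x) \<in> schwartz"
proof (rule schwartz_coinduct[where
    X = "\<lambda>f. \<exists>g. g \<in> schwartz \<and> f = (\<lambda>x. exp (2 * of_real pi * \<i> * (of_real x - c)) * g x)"])
  fix f assume "\<exists>g. g \<in> schwartz \<and> f = (\<lambda>x. exp (2 * of_real pi * \<i> * (of_real x - c)) * g x)"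
  then obtain g where g: "g \<in> schwartz" "f = (\<lambda>x. exp (2 * of_real pi * \<i> * (of_real x - c)) * g x)"
    by blast
  have exp': "((\<lambda>x. exp (2 * of_real pi * \<i> * (of_real x - c))) has_vector_derivative
      exp (2 * of_real pi * \<i> * (of_real x - c)) * (2 * of_real pi * \<i>)) (at x)" for x
    by (rule has_vector_derivative_real_field) (auto intro!: derivative_eq_intros)
  have "(f has_vector_derivative exp (2 * of_real pi * \<i> * (of_real x - c)) *
          ((2 * of_real pi * \<i>) * g x + 1 * vderiv g x)) (at x)" for x
    using has_vector_derivative_mult[OF exp' schwartz_has_vderiv[OF g(1)], of x]
    unfolding g(2) by (simp add: algebra_simps)
  thus "\<exists>f'. (\<exists>g. g \<in> schwartz \<and> f' = (\<lambda>x. exp (2 * of_real pi * \<i> * (of_real x - c)) * g x)) \<and>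
        (\<forall>x. (f has_vector_derivative f' x) (at x))"
    using schwartz_lincomb[OF g(1) schwartz_vderiv[OF g(1)], of "2 * of_real pi * \<i>" 1]
    by blast
  fix a
  obtain C where C: "\<And>x. \<bar>x\<bar> ^ a * cmod (g x) \<le> C" using schwartz_decay[OF g(1)] by blast
  \<comment> \<open>\<open>c\<close> may be complex, so the exponential has modulus exp(2 pi Im c)
    rather than 1.\<close>
  have "\<bar>x\<bar> ^ a * cmod (f x) \<le> exp (2 * pi * Im c) * C" for x
    using mult_left_mono[OF C[of x], of "exp (2 * pi * Im c)"]
    by (simp add: g norm_mult mult_ac)
  thus "\<exists>C. \<forall>x. \<bar>x\<bar> ^ a * cmod (f x) \<le> C" by blast
qed (use assms in blast)

text \<open>Expanding the power binomially reduces this to the plain decay bounds. The shift is |c|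
  for translations and 1 + R for estimates uniform on |x| \<le> R.\<close>

lemma schwartz_decay_shift:
  assumes "g \<in> schwartz"
  obtains C where "\<And>x. (c + \<bar>x\<bar>) ^ a * cmod (g x) \<le> C"
proof -
  have "\<forall>i. \<exists>C. \<forall>x. \<bar>x\<bar> ^ i * cmod (g x) \<le> C" using schwartz_decay[OF assms] by blast
  then obtain C where C: "\<And>i x. \<bar>x\<bar> ^ i * cmod (g x) \<le> C i" by metis
  have "(c + \<bar>x\<bar>) ^ a * cmod (g x) \<le> (\<Sum>i\<le>a. real (a choose i) * \<bar>c\<bar> ^ i * C (a - i))" for x
  proof -
    have "(c + \<bar>x\<bar>) ^ a * cmod (g x) \<le> (\<bar>c\<bar> + \<bar>x\<bar>) ^ a * cmod (g x)"
    proof (intro mult_right_mono)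
      have "(c + \<bar>x\<bar>) ^ a \<le> \<bar>c + \<bar>x\<bar>\<bar> ^ a" by (metis abs_ge_self power_abs)
      also have "\<dots> \<le> (\<bar>c\<bar> + \<bar>x\<bar>) ^ a" by (intro power_mono) auto
      finally show "(c + \<bar>x\<bar>) ^ a \<le> (\<bar>c\<bar> + \<bar>x\<bar>) ^ a" .
    qed auto
    also have "\<dots> = (\<Sum>i\<le>a. real (a choose i) * \<bar>c\<bar> ^ i * (\<bar>x\<bar> ^ (a - i) * cmod (g x)))"
      unfolding binomial_ring sum_distrib_right by (simp add: mult.assoc)
    also have "\<dots> \<le> (\<Sum>i\<le>a. real (a choose i) * \<bar>c\<bar> ^ i * C (a - i))"
      by (intro sum_mono mult_left_mono C) auto
    finally show ?thesis .
  qed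
  thus ?thesis using that by blast
qed

lemma schwartz_translate:
  assumes "g \<in> schwartz"
  shows "(\<lambda>x. g (x - c)) \<in> schwartz"
proof (rule schwartz_coinduct[where X = "\<lambda>f. \<exists>g. g \<in> schwartz \<and> f = (\<lambda>x. g (x - c))"])
  fix f assume "\<exists>g. g \<in> schwartz \<and> f = (\<lambda>x. g (x - c))"
  then obtain g where g: "g \<in> schwartz" "f = (\<lambda>x. g (x - c))"
    by blast
  have "(f has_vector_derivative vderiv g (x - c)) (at x)" for x
  proof -
    have "((\<lambda>x. x - c) has_vector_derivative 1) (at x)" by (auto intro!: derivative_eq_intros)
    from vector_diff_chain_at[OF this schwartz_has_vderiv[OF g(1)]]
    show ?thesis by (simp add: g(2) o_def)
  qed
  thus "\<exists>f'. (\<exists>g. g \<in> schwartz \<and> f' = (\<lambda>x. g (x - c))) \<and>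
        (\<forall>x. (f has_vector_derivative f' x) (at x))"
    using schwartz_vderiv[OF g(1)] by blast
  fix a
  obtain C where C: "\<And>x. (\<bar>c\<bar> + \<bar>x\<bar>) ^ a * cmod (g x) \<le> C" using schwartz_decay_shift[OF g(1)] by blast
  have "\<bar>x\<bar> ^ a * cmod (f x) \<le> C" for x
  proof -
    have "\<bar>x\<bar> ^ a * cmod (f x) \<le> (\<bar>c\<bar> + \<bar>x - c\<bar>) ^ a * cmod (g (x - c))"
      unfolding g(2) by (intro mult_right_mono power_mono) auto
    thus ?thesis using C[of "x - c"] by linarith
  qed
  thus "\<exists>C. \<forall>x. \<bar>x\<bar> ^ a * cmod (f x) \<le> C" by blast
qed (use assms in blast)

section \<open>Zak series and their derivatives\<close>

definition partial_s :: "(real \<times> int \<Rightarrow> complex) \<Rightarrow> real \<times> int \<Rightarrow> complex" where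
  "partial_s g = (\<lambda>(x, k). vderiv (\<lambda>s. g (s, k)) x)"

lemma schwartz_mod_periodic:
  assumes "g \<in> schwartz_mod n"
  shows "g (x, k + m * n) = g (x, k)"
proof -
  have p: "g (x, k + n) = g (x, k)" for k using assms by (simp add: schwartz_mod_def)
  show ?thesis
  proof (induction m rule: int_induct[where k = 0])
    case base
    show ?case by simp
  next
    case (step1 i)
    thus ?case using p[of "k + i * n"] by (simp add: algebra_simps)
  next
    case (step2 i)
    thus ?case using p[of "k + i * n - n"] by (simp add: algebra_simps)
  qed
qed

lemma schwartz_mod_D: "g \<in> schwartz_mod n \<Longrightarrow> (\<lambda>x. g (x, k)) \<in> schwartz"
  by (simp add: schwartz_mod_def)

lemma schwartz_mod_partial_s: "g \<in> schwartz_mod n \<Longrightarrow> partial_s g \<in> schwartz_mod n"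
  by (auto simp: schwartz_mod_def partial_s_def schwartz_vderiv)

lemma schwartz_mod_lincomb:
  "g \<in> schwartz_mod n \<Longrightarrow> h \<in> schwartz_mod n \<Longrightarrow> (\<lambda>p. c * g p + d * h p) \<in> schwartz_mod n"
  by (auto simp: schwartz_mod_def intro!: schwartz_lincomb)

lemma schwartz_mod_has_vderiv:
  assumes "g \<in> schwartz_mod n"
  shows "((\<lambda>s. g (s, k)) has_vector_derivative partial_s g (x, k)) (at x)"
  using schwartz_has_vderiv[OF schwartz_mod_D[OF assms]] by (simp add: partial_s_def)

text \<open>Decay in the real variable turns into decay in k: with s = x + k/n one has k = n (s -
  x), so 1 + |k| is at most |n| (1 + R + |s|). Uniformity in k holds because only finitely many
  functions \<open>g (_, k)\<close> occur, one for each residue of k modulo n.\<close>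

lemma schwartz_mod_decay:
  assumes g: "g \<in> schwartz_mod n" and "n \<noteq> 0" and "R \<ge> 0"
  obtains C where "\<And>x k. \<bar>x\<bar> \<le> R \<Longrightarrow> (1 + real_of_int \<bar>k\<bar>) ^ a * cmod (g (x + of_int k / of_int n, k)) \<le> C"
proof -
  have "\<forall>k. \<exists>C. \<forall>s. (1 + R + \<bar>s\<bar>) ^ a * cmod (g (s, k)) \<le> C"
    using schwartz_decay_shift[OF schwartz_mod_D[OF g], of "1 + R" a] by blast
  then obtain C where C: "\<And>k s. (1 + R + \<bar>s\<bar>) ^ a * cmod (g (s, k)) \<le> C k" by metis
  have C0: "C k \<ge> 0" for k
  proof -
    have "0 \<le> (1 + R + \<bar>0\<bar>) ^ a * cmod (g (0, k))" using \<open>R \<ge> 0\<close> by simp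
    thus ?thesis using C by (rule order.trans)
  qed
  \<comment> \<open>The remainder \<open>k mod n\<close> has the sign of \<open>n\<close>, so a
    symmetric interval covers both signs.\<close>
  define I where "I = {-\<bar>n\<bar>..\<bar>n\<bar>}"
  have "(1 + real_of_int \<bar>k\<bar>) ^ a * cmod (g (x + of_int k / of_int n, k)) \<le> real_of_int \<bar>n\<bar> ^ a * (\<Sum>i\<in>I. C i)"
    if x: "\<bar>x\<bar> \<le> R" for x k
  proof -
    define s where "s = x + of_int k / of_int n"
    have n1: "1 \<le> real_of_int \<bar>n\<bar>" using \<open>n \<noteq> 0\<close> by linarith
    have "real_of_int k = of_int n * (s - x)" using \<open>n \<noteq> 0\<close> by (simp add: s_def)
    hence "real_of_int \<bar>k\<bar> = real_of_int \<bar>n\<bar> * \<bar>s - x\<bar>" by (simp add: abs_mult)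
    also have "\<dots> \<le> real_of_int \<bar>n\<bar> * (R + \<bar>s\<bar>)" using x by (intro mult_left_mono) auto
    finally have k: "1 + real_of_int \<bar>k\<bar> \<le> real_of_int \<bar>n\<bar> * (1 + R + \<bar>s\<bar>)"
      using n1 by (simp add: algebra_simps)
    have "k mod n \<in> I"
    proof -
      have "\<bar>k mod n\<bar> < \<bar>n\<bar>" using abs_mod_less[OF \<open>n \<noteq> 0\<close>] by simp
      thus ?thesis by (auto simp: I_def)
    qed
    hence CI: "C (k mod n) \<le> (\<Sum>i\<in>I. C i)"
      by (intro member_le_sum) (auto simp: I_def C0)
    have gk: "g (s, k) = g (s, k mod n)"
      using schwartz_mod_periodic[OF g, of s "k mod n" "k div n"] by simp
    have "(1 + real_of_int \<bar>k\<bar>) ^ a * cmod (g (s, k)) \<le> (real_of_int \<bar>n\<bar> * (1 + R + \<bar>s\<bar>)) ^ a * cmod (g (s, k))"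
      by (intro mult_right_mono power_mono k) auto
    also have "\<dots> = real_of_int \<bar>n\<bar> ^ a * ((1 + R + \<bar>s\<bar>) ^ a * cmod (g (s, k mod n)))"
      by (simp add: power_mult_distrib gk)
    also have "\<dots> \<le> real_of_int \<bar>n\<bar> ^ a * (\<Sum>i\<in>I. C i)"
      by (intro mult_left_mono order.trans[OF C CI]) auto
    finally show ?thesis by (simp add: s_def)
  qed
  thus ?thesis using that by blast
qed

lemma zak_base_has_vderiv:
  assumes "g \<in> schwartz_mod n"
  shows "((\<lambda>x. g (x + of_int k / of_int n, k)) has_vector_derivative
      partial_s g (x + of_int k / of_int n, k)) (at x)"
proof -
  have "((\<lambda>x. x + of_int k / of_int n :: real) has_vector_derivative 1) (at x)"
    by (auto intro!: derivative_eq_intros)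
  from vector_diff_chain_at[OF this schwartz_mod_has_vderiv[OF assms]]
  show ?thesis by (simp add: o_def)
qed

text \<open>The profiles \<open>k \<mapsto> G(\<cdot>, k)\<close> of all iterated partial derivatives of the series
  \<open>\<Sum>\<^sub>k g(x + k/n; k) e(ky + nt)\<close>.\<close>

inductive zak_profile :: "int \<Rightarrow> (real \<Rightarrow> int \<Rightarrow> complex) \<Rightarrow> bool" for n where
  base: "g \<in> schwartz_mod n \<Longrightarrow> zak_profile n (\<lambda>x k. g (x + of_int k / of_int n, k))"
| lincomb: "zak_profile n G \<Longrightarrow> zak_profile n H \<Longrightarrow>
    zak_profile n (\<lambda>x k. (a + b * of_int k) * G x k + c * H x k)"

lemma zak_profile_deriv:
  assumes "zak_profile n G"
  shows "\<exists>G'. zak_profile n G' \<and> (\<forall>x k. ((\<lambda>x. G x k) has_vector_derivative G' x k) (at x))"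
  using assms
proof induction
  case (base g)
  show ?case
    using zak_base_has_vderiv[OF base] zak_profile.base[OF schwartz_mod_partial_s[OF base]] by blast
next
  case (lincomb G H a b c)
  then obtain G' H' where *: "zak_profile n G'" "zak_profile n H'"
    "\<And>x k. ((\<lambda>x. G x k) has_vector_derivative G' x k) (at x)"
    "\<And>x k. ((\<lambda>x. H x k) has_vector_derivative H' x k) (at x)" by blast
  have "((\<lambda>x. (a + b * of_int k) * G x k + c * H x k) has_vector_derivative
      (a + b * of_int k) * G' x k + c * H' x k) (at x)" for x k
    by (intro has_vector_derivative_add has_vector_derivative_mult_right *)
  thus ?case using zak_profile.lincomb[OF *(1,2)] by blast
qed

text \<open>A factor a + b k costs one power of 1 + |k|, so the induction treats all exponents
  \<open>m\<close> together and uses the bound for \<open>G\<close> at \<open>Suc m\<close>.\<close>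

lemma zak_profile_decay:
  assumes "zak_profile n G" "n \<noteq> 0" "R \<ge> 0"
  shows "\<exists>C. \<forall>x k. \<bar>x\<bar> \<le> R \<longrightarrow> (1 + real_of_int \<bar>k\<bar>) ^ m * cmod (G x k) \<le> C"
  using assms(1)
proof (induction arbitrary: m)
  case (base g)
  show ?case using schwartz_mod_decay[OF base assms(2,3)] by metis
next
  case (lincomb G H a b c)
  obtain C where C: "\<And>x k. \<bar>x\<bar> \<le> R \<Longrightarrow> (1 + real_of_int \<bar>k\<bar>) ^ Suc m * cmod (G x k) \<le> C"
    using lincomb.IH(1) by blast
  obtain D where D: "\<And>x k. \<bar>x\<bar> \<le> R \<Longrightarrow> (1 + real_of_int \<bar>k\<bar>) ^ m * cmod (H x k) \<le> D"
    using lincomb.IH(2) by blast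
  have "(1 + real_of_int \<bar>k\<bar>) ^ m * cmod ((a + b * of_int k) * G x k + c * H x k) \<le>
      (cmod a + cmod b) * C + cmod c * D" if x: "\<bar>x\<bar> \<le> R" for x k
  proof -
    have ab: "cmod (a + b * of_int k) \<le> (cmod a + cmod b) * (1 + real_of_int \<bar>k\<bar>)"
    proof -
      have "cmod (a + b * of_int k) \<le> cmod a + cmod b * real_of_int \<bar>k\<bar>"
        by (rule order.trans[OF norm_triangle_ineq]) (simp add: norm_mult)
      also have "\<dots> \<le> (cmod a + cmod b) * (1 + real_of_int \<bar>k\<bar>)"
        by (simp add: algebra_simps)
      finally show ?thesis .
    qed
    have "cmod ((a + b * of_int k) * G x k + c * H x k) \<le>
        (cmod a + cmod b) * (1 + real_of_int \<bar>k\<bar>) * cmod (G x k) + cmod c * cmod (H x k)"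
      using mult_right_mono[OF ab, of "cmod (G x k)"]
      by (intro order.trans[OF norm_triangle_ineq] add_mono) (auto simp: norm_mult)
    hence "(1 + real_of_int \<bar>k\<bar>) ^ m * cmod ((a + b * of_int k) * G x k + c * H x k) \<le>
      (1 + real_of_int \<bar>k\<bar>) ^ m *
        ((cmod a + cmod b) * (1 + real_of_int \<bar>k\<bar>) * cmod (G x k) + cmod c * cmod (H x k))"
      by (intro mult_left_mono) auto
    also have "\<dots> = (cmod a + cmod b) * ((1 + real_of_int \<bar>k\<bar>) ^ Suc m * cmod (G x k)) +
        cmod c * ((1 + real_of_int \<bar>k\<bar>) ^ m * cmod (H x k))"
      by (simp add: algebra_simps)
    also have "\<dots> \<le> (cmod a + cmod b) * C + cmod c * D"
      by (intro add_mono mult_left_mono C D x) auto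
    finally show ?thesis .
  qed
  thus ?case by blast
qed

section \<open>Summation over the integers and termwise differentiation\<close>

lemma summable_on_int_inverse_square:
  "(\<lambda>k::int. C / (1 + real_of_int \<bar>k\<bar>) ^ 2) summable_on UNIV"
proof -
  have "summable (\<lambda>n. inverse (real (Suc n) ^ 2))"
    using inverse_power_summable[of 2, where 'a = real] by (subst summable_Suc_iff) auto
  hence N: "(\<lambda>n. inverse ((1 + real n) ^ 2)) summable_on UNIV"
    by (intro norm_summable_imp_summable_on) (simp add: add_ac)
  have "(\<lambda>k::int. inverse ((1 + real_of_int \<bar>k\<bar>) ^ 2)) summable_on range int"
    using N by (subst summable_on_reindex) (auto simp: o_def)
  moreover have "(\<lambda>k::int. inverse ((1 + real_of_int \<bar>k\<bar>) ^ 2)) summable_on range (\<lambda>n. - int n)"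
    using N by (subst summable_on_reindex) (auto simp: o_def inj_on_def)
  ultimately have "(\<lambda>k::int. inverse ((1 + real_of_int \<bar>k\<bar>) ^ 2)) summable_on (range int \<union> range (\<lambda>n. - int n))"
    by (rule summable_on_union)
  moreover have "range int \<union> range (\<lambda>n. - int n) = UNIV"
  proof -
    have "k \<in> range int \<union> range (\<lambda>n. - int n)" for k by (cases k rule: int_cases2) auto
    thus ?thesis by blast
  qed
  ultimately have "(\<lambda>k::int. inverse ((1 + real_of_int \<bar>k\<bar>) ^ 2)) summable_on UNIV" by simp
  thus ?thesis unfolding divide_inverse by (rule summable_on_cmult_right)
qed

text \<open>Absolute convergence makes the order of summation irrelevant. Enumerating the integers
  by \<open>int_decode\<close> opens the way to the theorem on differentiating ordinary
  series.\<close>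

lemma infsum_int_eq_suminf:
  fixes f :: "int \<Rightarrow> 'b::banach"
  assumes "M summable_on UNIV" "\<And>k. norm (f k) \<le> M k"
  shows "summable (\<lambda>i. norm (f (int_decode i)))"
    and "(\<Sum>\<^sub>\<infinity>k. f k) = (\<Sum>i. f (int_decode i))"
proof -
  have b: "bij_betw int_decode UNIV UNIV" by (rule bij_int_decode)
  have "(\<lambda>k. norm (f k)) summable_on UNIV"
    by (rule Infinite_Sum.abs_summable_on_comparison_test'[OF assms(1)]) (rule assms(2))
  hence "(\<lambda>i. norm (f (int_decode i))) summable_on UNIV"
    using summable_on_reindex_bij_betw[OF b, of "\<lambda>k. norm (f k)"] by simp
  thus s: "summable (\<lambda>i. norm (f (int_decode i)))" by (rule summable_on_imp_summable)
  have "((\<lambda>i. f (int_decode i)) has_sum (\<Sum>i. f (int_decode i))) UNIV"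
    by (intro norm_summable_imp_has_sum s summable_sums summable_norm_cancel[OF s])
  hence "(\<Sum>\<^sub>\<infinity>i. f (int_decode i)) = (\<Sum>i. f (int_decode i))" by (rule infsumI)
  thus "(\<Sum>\<^sub>\<infinity>k. f k) = (\<Sum>i. f (int_decode i))"
    using infsum_reindex_bij_betw[OF b, of f] by simp
qed

lemma has_derivative_infsum_int:
  fixes f :: "int \<Rightarrow> 'a::real_normed_vector \<Rightarrow> 'b::banach"
  assumes S: "convex S" "open S" and p: "p \<in> S"
    and f': "\<And>k x. x \<in> S \<Longrightarrow> (f k has_derivative f' k x) (at x)"
    and M: "M summable_on UNIV"
    and fM: "\<And>k x. x \<in> S \<Longrightarrow> norm (f k x) \<le> M k"
    and f'M: "\<And>k x h. x \<in> S \<Longrightarrow> norm (f' k x h) \<le> M k * norm h"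
  shows "((\<lambda>x. \<Sum>\<^sub>\<infinity>k. f k x) has_derivative (\<lambda>h. \<Sum>\<^sub>\<infinity>k. f' k p h)) (at p)"
proof -
  let ?d = int_decode
  have "norm (M k) = M k" for k
    using order.trans[OF norm_ge_zero fM[OF p, of k]] by simp
  hence "summable (\<lambda>i. norm (M (?d i)))" using infsum_int_eq_suminf(1)[OF M, of M] by simp
  hence Ms: "summable (\<lambda>i. M (?d i))" by (rule summable_norm_cancel)
  have sf: "summable (\<lambda>i. f (?d i) x)" "(\<Sum>\<^sub>\<infinity>k. f k x) = (\<Sum>i. f (?d i) x)" if "x \<in> S" for x
    using infsum_int_eq_suminf[OF M fM[OF that]] summable_norm_cancel by auto
  have Mh: "(\<lambda>k. M k * norm h) summable_on UNIV" for h :: 'a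
    using M by (rule summable_on_cmult_left)
  have sf': "summable (\<lambda>i. norm (f' (?d i) x h))"
    "(\<Sum>\<^sub>\<infinity>k. f' k x h) = (\<Sum>i. f' (?d i) x h)" if "x \<in> S" for x h
    using infsum_int_eq_suminf[OF Mh f'M[OF that]] by auto
  have "\<exists>g. \<forall>x\<in>S. (\<lambda>i. f (?d i) x) sums g x \<and>
      (g has_derivative (\<lambda>h. \<Sum>i. f' (?d i) x h)) (at x within S)"
  proof (rule has_derivative_series[where f = "\<lambda>i. f (?d i)" and f' = "\<lambda>i. f' (?d i)",
        OF S(1) _ _ p summable_sums])
    show "summable (\<lambda>i. f (?d i) p)" by (rule sf(1)[OF p])
    show "(f (?d i) has_derivative f' (?d i) x) (at x within S)" if "x \<in> S" for i x
      using f'[OF that] has_derivative_at_withinI by blast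
    fix e :: real assume "e > 0"
    \<comment> \<open>The tail of the majorant is independent of the point and bounds the tail of
      the derivatives up to \<open>norm h\<close>; this is the uniform convergence that termwise
      differentiation requires.\<close>
    from suminf_exist_split[OF this Ms] obtain N where
      N: "\<And>n. n \<ge> N \<Longrightarrow> norm (\<Sum>i. M (?d (i + n))) < e" by blast
    have "norm (sum (\<lambda>i. f' (?d i) x h) {..<n} - (\<Sum>i. f' (?d i) x h)) \<le> e * norm h"
      if n: "n \<ge> N" and x: "x \<in> S" for n x h
    proof -
      have s: "summable (\<lambda>i. norm (f' (?d (i + n)) x h))"
        using summable_ignore_initial_segment[OF sf'(1)[OF x, of h], of n] .
      have "(\<Sum>i. f' (?d i) x h) - sum (\<lambda>i. f' (?d i) x h) {..<n} = (\<Sum>i. f' (?d (i + n)) x h)"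
        by (rule suminf_minus_initial_segment[symmetric]) (rule summable_norm_cancel[OF sf'(1)[OF x]])
      hence "norm (sum (\<lambda>i. f' (?d i) x h) {..<n} - (\<Sum>i. f' (?d i) x h)) = norm (\<Sum>i. f' (?d (i + n)) x h)"
        by (metis norm_minus_commute)
      also have "\<dots> \<le> (\<Sum>i. norm (f' (?d (i + n)) x h))" by (rule summable_norm[OF s])
      also have "\<dots> \<le> (\<Sum>i. M (?d (i + n)) * norm h)"
        by (intro suminf_le s f'M x summable_mult2 summable_ignore_initial_segment[OF Ms])
      also have "\<dots> = (\<Sum>i. M (?d (i + n))) * norm h"
        by (rule suminf_mult2[symmetric]) (rule summable_ignore_initial_segment[OF Ms])
      also have "\<dots> \<le> e * norm h"
        using N[OF n] by (intro mult_right_mono) auto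
      finally show ?thesis .
    qed
    thus "\<forall>\<^sub>F n in sequentially. \<forall>x\<in>S. \<forall>h.
        norm (sum (\<lambda>i. f' (?d i) x h) {..<n} - (\<Sum>i. f' (?d i) x h)) \<le> e * norm h"
      unfolding eventually_sequentially by blast
  qed
  then obtain g where g: "\<And>x. x \<in> S \<Longrightarrow> (\<lambda>i. f (?d i) x) sums g x"
    "\<And>x. x \<in> S \<Longrightarrow> (g has_derivative (\<lambda>h. \<Sum>i. f' (?d i) x h)) (at x within S)" by blast
  have "(g has_derivative (\<lambda>h. \<Sum>\<^sub>\<infinity>k. f' k p h)) (at p)"
    using g(2)[OF p] at_within_open[OF p S(2)] sf'(2)[OF p] by simp
  moreover have "g x = (\<Sum>\<^sub>\<infinity>k. f k x)" if "x \<in> S" for x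
    using g(1)[OF that] sf(2)[OF that] by (simp add: sums_unique)
  ultimately show ?thesis
    by (rule has_derivative_transform_within_open[OF _ S(2) p]) auto
qed

text \<open>The coefficient is an arbitrary function of x and k, because a weight k from d/dy
  destroys the n-periodicity that \<open>wbz_sum\<close> expects of its argument.\<close>

definition zak_series :: "int \<Rightarrow> (real \<Rightarrow> int \<Rightarrow> complex) \<Rightarrow> point \<Rightarrow> complex" where
  "zak_series n G = (\<lambda>(x, y, t). \<Sum>\<^sub>\<infinity>k. G x k *
     exp (2 * of_real pi * \<i> * (of_int k * of_real y + of_int n * of_real t)))"

lemma wbz_sum_eq_zak_series:
  "wbz_sum n g = zak_series n (\<lambda>x k. g (x + of_int k / of_int n, k))"
  by (simp add: wbz_sum_def zak_series_def)

text \<open>The derivative is arranged so that the same exponential stands beside a coefficient of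
  the shape in \<open>zak_profile.lincomb\<close>, with a = 2 pi i n w, b = 2 pi i v and c = u for
  the direction (u, v, w). A directional derivative of a Zak series is then visibly a Zak
  series.\<close>

lemma zak_term_has_derivative:
  assumes "((\<lambda>x. G x k) has_vector_derivative G' x k) (at x)"
  shows "((\<lambda>(x, y, t). G x k *
            exp (2 * of_real pi * \<i> * (of_int k * of_real y + of_int n * of_real t)))
    has_derivative (\<lambda>(u, v, w).
        ((2 * of_real pi * \<i> * of_int n * of_real w + 2 * of_real pi * \<i> * of_real v * of_int k) * G x k
          + of_real u * G' x k) *
        exp (2 * of_real pi * \<i> * (of_int k * of_real y + of_int n * of_real t)))) (at (x, y, t))"
proof -
  have G: "((\<lambda>p. G (fst p) k) has_derivative (\<lambda>h. fst h *\<^sub>R G' x k)) (at (x, y, t))"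
    using has_derivative_compose[of fst fst "(x, y, t)" UNIV "\<lambda>x. G x k" "\<lambda>v. v *\<^sub>R G' x k"] assms
    by (auto simp: has_vector_derivative_def has_derivative_fst)
  let ?E = "\<lambda>p::point. exp (2 * of_real pi * \<i> * (of_int k * of_real (fst (snd p)) + of_int n * of_real (snd (snd p))))"
  have "((\<lambda>p::point. 2 * of_real pi * \<i> * (of_int k * of_real (fst (snd p)) + of_int n * of_real (snd (snd p))) :: complex)
      has_derivative (\<lambda>h. 2 * of_real pi * \<i> * (of_int k * of_real (fst (snd h)) + of_int n * of_real (snd (snd h)))))
      (at (x, y, t))"
    by (intro has_derivative_mult_right has_derivative_add has_derivative_of_real
        has_derivative_fst has_derivative_snd has_derivative_ident)
  from has_derivative_compose[OF this DERIV_exp[unfolded has_field_derivative_def]]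
  have E: "(?E has_derivative (\<lambda>h. (2 * of_real pi * \<i> *
       (of_int k * of_real (fst (snd h)) + of_int n * of_real (snd (snd h)))) * ?E (x, y, t))) (at (x, y, t))"
    by (simp add: mult.commute)
  have "((\<lambda>p. G (fst p) k * ?E p) has_derivative
     (\<lambda>h. G x k * ((2 * of_real pi * \<i> *
       (of_int k * of_real (fst (snd h)) + of_int n * of_real (snd (snd h)))) * ?E (x, y, t)) +
       (fst h *\<^sub>R G' x k) * ?E (x, y, t))) (at (x, y, t))"
    using has_derivative_mult[OF G E] by simp
  thus ?thesis
    by (simp add: case_prod_unfold algebra_simps scaleR_conv_of_real)
qed

text \<open>Two further powers of decay are spent on the summable factor 1 / (1 + |k|)^2.\<close>

lemma zak_profile_summable_bound:
  assumes "zak_profile n G" "n \<noteq> 0" "R \<ge> 0"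
  obtains C where "C \<ge> 0"
    "\<And>x k. \<bar>x\<bar> \<le> R \<Longrightarrow> (1 + real_of_int \<bar>k\<bar>) ^ m * cmod (G x k) \<le> C / (1 + real_of_int \<bar>k\<bar>) ^ 2"
proof -
  obtain C where C: "\<And>x k. \<bar>x\<bar> \<le> R \<Longrightarrow> (1 + real_of_int \<bar>k\<bar>) ^ (m + 2) * cmod (G x k) \<le> C"
    using zak_profile_decay[OF assms] by blast
  have "0 \<le> (1 + real_of_int \<bar>0\<bar>) ^ (m + 2) * cmod (G 0 0)" by simp
  also have "\<dots> \<le> C" using C[of 0 0] \<open>R \<ge> 0\<close> by simp
  finally have C0: "C \<ge> 0" .
  have "(1 + real_of_int \<bar>k\<bar>) ^ m * cmod (G x k) \<le> C / (1 + real_of_int \<bar>k\<bar>) ^ 2"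
    if "\<bar>x\<bar> \<le> R" for x k
  proof -
    have "(1 + real_of_int \<bar>k\<bar>) ^ m * cmod (G x k) * (1 + real_of_int \<bar>k\<bar>) ^ 2 \<le> C"
      using C[OF that, of k] by (simp add: power_add power2_eq_square mult_ac)
    moreover have "0 < (1 + real_of_int \<bar>k\<bar>) ^ 2" by (intro zero_less_power) linarith
    ultimately show ?thesis by (simp add: pos_le_divide_eq)
  qed
  with C0 show ?thesis using that by blast
qed

lemma zak_series_has_derivative:
  assumes G: "zak_profile n G" and G': "zak_profile n G'"
    and der: "\<And>x k. ((\<lambda>x. G x k) has_vector_derivative G' x k) (at x)"
    and n: "n \<noteq> 0"
  shows "(zak_series n G has_derivative (\<lambda>(u, v, w). zak_series n (\<lambda>x k.
      (2 * of_real pi * \<i> * of_int n * of_real w + 2 * of_real pi * \<i> * of_real v * of_int k) * G x k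
          + of_real u * G' x k) p)) (at p)"
proof -
  obtain x y t where p: "p = (x, y, t)" by (cases p)
  \<comment> \<open>Profiles are bounded uniformly only for bounded first coordinate, hence a strip
    around \<open>p\<close>; y and t stay free because the exponentials have modulus 1.\<close>
  define R where "R = \<bar>x\<bar> + 1"
  have R: "R \<ge> 0" by (simp add: R_def)
  define S :: "point set" where "S = {-R<..<R} \<times> UNIV"
  \<comment> \<open>Exponent 1 for \<open>G\<close>, which d/dy multiplies by k; exponent 0 suffices
    for \<open>G'\<close>.\<close>
  obtain C where C: "C \<ge> 0"
    "\<And>x k. \<bar>x\<bar> \<le> R \<Longrightarrow> (1 + real_of_int \<bar>k\<bar>) ^ 1 * cmod (G x k) \<le> C / (1 + real_of_int \<bar>k\<bar>) ^ 2"
    using zak_profile_summable_bound[OF G n R] by blast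
  obtain D where D: "D \<ge> 0"
    "\<And>x k. \<bar>x\<bar> \<le> R \<Longrightarrow> (1 + real_of_int \<bar>k\<bar>) ^ 0 * cmod (G' x k) \<le> D / (1 + real_of_int \<bar>k\<bar>) ^ 2"
    using zak_profile_summable_bound[OF G' n R] by blast
  \<comment> \<open>\<open>A\<close> comes from |n w + v k| \<le> |h| (1 + |k|) (1 + |n|) for h =
    (u, v, w). It is at least 1, so that \<open>E\<close> below majorises the terms as well as their
    derivatives.\<close>
  define A where "A = 2 * pi * (1 + real_of_int \<bar>n\<bar>)"
  have A1: "A \<ge> 1"
  proof -
    have "1 * 1 \<le> (2 * pi) * (1 + real_of_int \<bar>n\<bar>)" using pi_gt3 by (intro mult_mono) auto
    thus ?thesis by (simp add: A_def)
  qed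
  define E where "E = A * C + D"
  define f where "f = (\<lambda>k::int. \<lambda>(x, y, t). G x k *
     exp (2 * of_real pi * \<i> * (of_int k * of_real y + of_int n * of_real t)))"
  define f' where "f' = (\<lambda>k::int. \<lambda>(x, y, t) (u, v, w).
        ((2 * of_real pi * \<i> * of_int n * of_real w + 2 * of_real pi * \<i> * of_real v * of_int k) * G x k
          + of_real u * G' x k) *
        exp (2 * of_real pi * \<i> * (of_int k * of_real y + of_int n * of_real t)))"
  have "((\<lambda>x. \<Sum>\<^sub>\<infinity>k. f k x) has_derivative (\<lambda>h. \<Sum>\<^sub>\<infinity>k. f' k p h)) (at p)"
  proof (rule has_derivative_infsum_int[where S = S and M = "\<lambda>k. E / (1 + real_of_int \<bar>k\<bar>) ^ 2"])
    show "convex S" "open S" unfolding S_def by (intro convex_Times open_Times; simp)+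
    show "p \<in> S" by (auto simp: S_def R_def p)
    show "(f k has_derivative f' k q) (at q)" for k q
      unfolding f_def f'_def
      using zak_term_has_derivative[where G = G and G' = G' and k = k and n = n, OF der]
      by (cases q) auto
    show "(\<lambda>k. E / (1 + real_of_int \<bar>k\<bar>) ^ 2) summable_on UNIV" by (rule summable_on_int_inverse_square)
    fix k and q :: point assume "q \<in> S"
    then obtain x y t where q: "q = (x, y, t)" "\<bar>x\<bar> \<le> R" by (auto simp: S_def)
    have k1: "1 + real_of_int \<bar>k\<bar> \<ge> 1" by simp
    have Gk: "cmod (G x k) * (1 + real_of_int \<bar>k\<bar>) \<le> C / (1 + real_of_int \<bar>k\<bar>) ^ 2"
      using C(2)[OF q(2), of k] by (simp add: mult.commute)
    have G'k: "cmod (G' x k) \<le> D / (1 + real_of_int \<bar>k\<bar>) ^ 2" using D(2)[OF q(2), of k] by simp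
    have "cmod (G x k) \<le> cmod (G x k) * (1 + real_of_int \<bar>k\<bar>)"
      using mult_left_mono[OF k1, of "cmod (G x k)"] by simp
    also note Gk
    also have "C / (1 + real_of_int \<bar>k\<bar>) ^ 2 \<le> E / (1 + real_of_int \<bar>k\<bar>) ^ 2"
    proof (rule divide_right_mono)
      show "C \<le> E" using mult_right_mono[OF A1 C(1)] D(1) by (simp add: E_def)
    qed simp
    finally show "cmod (f k q) \<le> E / (1 + real_of_int \<bar>k\<bar>) ^ 2"
      by (simp add: f_def q norm_mult)
    fix h :: point
    obtain u v w where h: "h = (u, v, w)" by (cases h)
    have uh: "\<bar>u\<bar> \<le> norm h" and vh: "\<bar>v\<bar> \<le> norm h" and wh: "\<bar>w\<bar> \<le> norm h"
      using norm_fst_le[of u "(v, w)"] norm_snd_le[of "(v, w)" u] norm_fst_le[of v w] norm_snd_le[of w v]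
      by (simp_all add: h)
    have nwk: "cmod (2 * of_real pi * \<i> * of_int n * of_real w + 2 * of_real pi * \<i> * of_real v * of_int k)
        \<le> A * norm h * (1 + real_of_int \<bar>k\<bar>)"
    proof -
      have "cmod (2 * of_real pi * \<i> * of_int n * of_real w + 2 * of_real pi * \<i> * of_real v * of_int k)
          \<le> 2 * pi * (real_of_int \<bar>n\<bar> * \<bar>w\<bar> + \<bar>v\<bar> * real_of_int \<bar>k\<bar>)"
        by (rule order.trans[OF norm_triangle_ineq]) (simp add: norm_mult algebra_simps)
      also have "\<dots> \<le> 2 * pi * (real_of_int \<bar>n\<bar> * norm h + norm h * real_of_int \<bar>k\<bar>)"
        by (intro mult_left_mono mult_right_mono add_mono wh vh) auto
      also have "\<dots> \<le> 2 * pi * (norm h * (1 + real_of_int \<bar>k\<bar>) * (1 + real_of_int \<bar>n\<bar>))"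
        by (intro mult_left_mono) (auto simp: algebra_simps)
      finally show ?thesis by (simp add: A_def mult_ac)
    qed
    have "cmod (f' k q h) \<le> A * norm h * (1 + real_of_int \<bar>k\<bar>) * cmod (G x k) + norm h * cmod (G' x k)"
      unfolding f'_def q h prod.case norm_mult
      using mult_right_mono[OF nwk, of "cmod (G x k)"] mult_right_mono[OF uh, of "cmod (G' x k)"]
      by (auto simp: norm_mult h intro!: order.trans[OF norm_triangle_ineq] add_mono)
    also have "\<dots> = A * norm h * (cmod (G x k) * (1 + real_of_int \<bar>k\<bar>)) + norm h * cmod (G' x k)"
      by (simp add: mult_ac)
    also have "\<dots> \<le> A * norm h * (C / (1 + real_of_int \<bar>k\<bar>) ^ 2) + norm h * (D / (1 + real_of_int \<bar>k\<bar>) ^ 2)"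
      using A1 by (intro add_mono mult_left_mono Gk G'k) auto
    also have "\<dots> = E / (1 + real_of_int \<bar>k\<bar>) ^ 2 * norm h"
      by (simp add: E_def add_divide_distrib algebra_simps)
    finally show "cmod (f' k q h) \<le> E / (1 + real_of_int \<bar>k\<bar>) ^ 2 * norm h" .
  qed
  thus ?thesis
    by (simp add: zak_series_def f_def f'_def p case_prod_unfold)
qed

lemma smooth_zak_series:
  assumes "zak_profile n G" "n \<noteq> 0"
  shows "smooth (zak_series n G)"
proof (rule smooth_coinduct[where X = "\<lambda>f. \<exists>G. zak_profile n G \<and> f = zak_series n G"])
  show "\<exists>G'. zak_profile n G' \<and> zak_series n G = zak_series n G'" using assms by blast
next
  fix f x assume "\<exists>G. zak_profile n G \<and> f = zak_series n G"
  thus "f differentiable (at x)"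
    using zak_series_has_derivative zak_profile_deriv \<open>n \<noteq> 0\<close> unfolding differentiable_def by blast
next
  fix f and v :: point assume "\<exists>G. zak_profile n G \<and> f = zak_series n G"
  then obtain G where G: "zak_profile n G" "f = zak_series n G" by blast
  obtain G' where G': "zak_profile n G'" "\<And>x k. ((\<lambda>x. G x k) has_vector_derivative G' x k) (at x)"
    using zak_profile_deriv[OF G(1)] by blast
  obtain a b c where v: "v = (a, b, c)" by (cases v)
  have "frechet_derivative f (at x) v = zak_series n (\<lambda>x k.
      (2 * of_real pi * \<i> * of_int n * of_real c + 2 * of_real pi * \<i> * of_real b * of_int k) * G x k
          + of_real a * G' x k) x" for x
    using frechet_derivative_at[OF zak_series_has_derivative[OF G(1) G' \<open>n \<noteq> 0\<close>, of x], symmetric]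
    by (simp add: G v)
  thus "\<exists>G. zak_profile n G \<and> (\<lambda>x. frechet_derivative f (at x) v) = zak_series n G"
    using zak_profile.lincomb[OF G(1) G'(1)] by blast
qed

section \<open>Injectivity of the Zak series and the Heisenberg operators\<close>

lemma exp_2pi_i_add_int:
  "exp (2 * of_real pi * \<i> * (z + of_int m)) = exp (2 * of_real pi * \<i> * z)"
  using exp_plus_2pin[of "2 * of_real pi * \<i> * z" m] by (simp add: algebra_simps)

lemma has_integral_exp_2pi_i_int:
  "((\<lambda>y. exp (2 * of_real pi * \<i> * (of_int m * of_real y))) has_integral (if m = 0 then 1 else 0)) {0..1::real}"
proof (cases "m = 0")
  case True
  thus ?thesis using has_integral_const_real[of "1::complex" 0 1] by simp
next
  case False
  let ?c = "2 * of_real pi * \<i> * of_int m :: complex"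
  have "?c \<noteq> 0" using False by simp
  hence "((\<lambda>y. exp (?c * of_real y) / ?c) has_vector_derivative exp (?c * of_real y)) (at y within {0..1})" for y
    by (intro has_vector_derivative_real_field) (auto intro!: derivative_eq_intros)
  hence "((\<lambda>y. exp (?c * of_real y)) has_integral exp (?c * of_real 1) / ?c - exp (?c * of_real 0) / ?c) {0..1}"
    by (intro fundamental_theorem_of_calculus) auto
  moreover have "exp (?c * of_real 1) = 1" using exp_2pi_i_add_int[of 0 m] by simp
  ultimately show ?thesis using False by (simp add: mult.assoc)
qed

text \<open>Absolute summability gives uniform convergence in y by the Weierstrass test. Multiplying
  by e(-l y) and integrating over [0, 1] therefore commutes with the sum, and orthogonality leaves
  only \<open>c l\<close>: the integral of a finite partial sum equals \<open>c l\<close> as soon as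
  its index set contains \<open>l\<close>.\<close>

lemma fourier_coeff_eq_0:
  fixes c :: "int \<Rightarrow> complex"
  assumes "(\<lambda>k. norm (c k)) summable_on UNIV"
    and "\<And>y::real. (\<Sum>\<^sub>\<infinity>k. c k * exp (2 * of_real pi * \<i> * (of_int k * of_real y))) = 0"
  shows "c l = 0"
proof -
  define f where "f = (\<lambda>k (y::real). c k * exp (2 * of_real pi * \<i> * (of_int (k - l) * of_real y)))"
  have "uniform_limit {0..1} (\<lambda>F y. \<Sum>k\<in>F. f k y) (\<lambda>y. \<Sum>\<^sub>\<infinity>k. f k y) (finite_subsets_at_top UNIV)"
    by (rule Weierstrass_m_test_general[OF _ assms(1)]) (auto simp: f_def norm_mult)
  moreover have "(\<Sum>\<^sub>\<infinity>k. f k y) = 0" for y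
  proof -
    have "f k y = exp (- (2 * of_real pi * \<i> * (of_int l * of_real y))) *
        (c k * exp (2 * of_real pi * \<i> * (of_int k * of_real y)))" for k
      by (simp add: f_def exp_diff exp_minus field_simps)
    thus ?thesis by (simp only: infsum_cmult_right' assms(2)) simp
  qed
  ultimately have u: "uniform_limit {0..1} (\<lambda>F y. \<Sum>k\<in>F. f k y) (\<lambda>y. 0) (finite_subsets_at_top UNIV)"
    by simp
  have cont: "continuous_on {0..1} (\<lambda>y. \<Sum>k\<in>F. f k y)" for F
    unfolding f_def by (intro continuous_intros)
  obtain I J where I: "\<And>F. ((\<lambda>y. \<Sum>k\<in>F. f k y) has_integral I F) {0..1}"
    and J: "((\<lambda>y::real. 0::complex) has_integral J) {0..1}" and lim: "(I \<longlongrightarrow> J) (finite_subsets_at_top UNIV)"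
    using uniform_limit_integral[OF u cont] by auto
  have "J = 0" using J by (simp add: has_integral_iff)
  have "I F = c l" if F: "finite F" "l \<in> F" for F
  proof -
    have "(f k has_integral c k * (if k - l = 0 then 1 else 0)) {0..1}" for k
      unfolding f_def by (intro has_integral_mult_right has_integral_exp_2pi_i_int)
    hence "((\<lambda>y. \<Sum>k\<in>F. f k y) has_integral (\<Sum>k\<in>F. c k * (if k - l = 0 then 1 else 0))) {0..1}"
      by (intro has_integral_sum F(1))
    hence "I F = (\<Sum>k\<in>F. c k * (if k - l = 0 then 1 else 0))"
      using I has_integral_unique by blast
    also have "\<dots> = (\<Sum>k\<in>F. if k = l then c k else 0)" by (intro sum.cong) auto
    also have "\<dots> = c l" using F by simp
    finally show ?thesis .
  qed
  hence "eventually (\<lambda>F. I F = c l) (finite_subsets_at_top UNIV)"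
    unfolding eventually_finite_subsets_at_top by (intro exI[of _ "{l}"]) auto
  hence "(I \<longlongrightarrow> c l) (finite_subsets_at_top UNIV)" by (rule tendsto_eventually)
  with lim have "c l = J" using tendsto_unique finite_subsets_at_top_neq_bot by blast
  thus ?thesis using \<open>J = 0\<close> by simp
qed

section \<open>Linearity and injectivity of the Zak series\<close>

lemma zak_series_summable:
  assumes "zak_profile n G" "n \<noteq> 0"
  shows "(\<lambda>k. norm (G x k)) summable_on UNIV"
    and "(\<lambda>k. G x k * exp (2 * of_real pi * \<i> * (of_int k * of_real y + of_int n * of_real t))) summable_on UNIV"
proof -
  obtain C where "\<And>z k. \<bar>z\<bar> \<le> \<bar>x\<bar> \<Longrightarrow>
      (1 + real_of_int \<bar>k\<bar>) ^ 0 * cmod (G z k) \<le> C / (1 + real_of_int \<bar>k\<bar>) ^ 2"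
    using zak_profile_summable_bound[OF assms abs_ge_zero[of x]] by blast
  note C = this[OF order_refl]
  show 1: "(\<lambda>k. norm (G x k)) summable_on UNIV"
    by (rule Infinite_Sum.abs_summable_on_comparison_test'[OF summable_on_int_inverse_square[of C]])
       (use C in simp)
  show "(\<lambda>k. G x k * exp (2 * of_real pi * \<i> * (of_int k * of_real y + of_int n * of_real t))) summable_on UNIV"
    by (rule abs_summable_summable) (use 1 in \<open>simp add: norm_mult\<close>)
qed

lemma zak_series_lincomb:
  assumes "zak_profile n G" "zak_profile n H" "n \<noteq> 0"
  shows "zak_series n (\<lambda>x k. c * G x k + d * H x k) p = c * zak_series n G p + d * zak_series n H p"
proof -
  obtain x y t where p: "p = (x, y, t)" by (cases p)
  let ?e = "\<lambda>k. exp (2 * of_real pi * \<i> * (of_int k * of_real y + of_int n * of_real t))"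
  have "(\<Sum>\<^sub>\<infinity>k. c * (G x k * ?e k) + d * (H x k * ?e k)) =
      (\<Sum>\<^sub>\<infinity>k. c * (G x k * ?e k)) + (\<Sum>\<^sub>\<infinity>k. d * (H x k * ?e k))"
    by (intro infsum_add summable_on_cmult_right zak_series_summable assms)
  thus ?thesis
    by (simp add: zak_series_def p infsum_cmult_right' algebra_simps)
qed

lemma wbz_sum_lincomb:
  assumes "g \<in> schwartz_mod n" "h \<in> schwartz_mod n" "n \<noteq> 0"
  shows "wbz_sum n (\<lambda>p. c * g p + d * h p) p = c * wbz_sum n g p + d * wbz_sum n h p"
  unfolding wbz_sum_eq_zak_series
  using zak_series_lincomb[OF zak_profile.base[OF assms(1)] zak_profile.base[OF assms(2)] assms(3)] .

lemma wbz_sum_cmult: "wbz_sum n (\<lambda>p. c * g p) p = c * wbz_sum n g p"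
  by (simp add: wbz_sum_def case_prod_unfold mult.assoc infsum_cmult_right')

lemma zero_schwartz_mod: "(\<lambda>p. 0) \<in> schwartz_mod n"
proof -
  have "(\<lambda>x. 0) \<in> schwartz"
    by (rule schwartz_coinduct[where X = "\<lambda>f. f = (\<lambda>x. 0)"]) auto
  thus ?thesis by (simp add: schwartz_mod_def)
qed

lemma schwartz_mod_cmult: "g \<in> schwartz_mod n \<Longrightarrow> (\<lambda>p. c * g p) \<in> schwartz_mod n"
  using schwartz_mod_lincomb[of g n "\<lambda>p. 0" c 0] zero_schwartz_mod by simp

lemma schwartz_mod_sum:
  assumes "\<And>i. i \<in> I \<Longrightarrow> g i \<in> schwartz_mod n"
  shows "(\<lambda>p. \<Sum>i\<in>I. c i * g i p) \<in> schwartz_mod n"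
  using assms
proof (induction I rule: infinite_finite_induct)
  case (insert i I)
  thus ?case using schwartz_mod_lincomb[of "g i" n "\<lambda>p. \<Sum>i\<in>I. c i * g i p" "c i" 1] by simp
qed (simp_all add: zero_schwartz_mod)

lemma wbz_sum_sum:
  assumes "\<And>i. i \<in> I \<Longrightarrow> g i \<in> schwartz_mod n" "n \<noteq> 0"
  shows "wbz_sum n (\<lambda>p. \<Sum>i\<in>I. c i * g i p) p = (\<Sum>i\<in>I. c i * wbz_sum n (g i) p)"
  using assms(1)
proof (induction I rule: infinite_finite_induct)
  case (insert i I)
  thus ?case
    using wbz_sum_lincomb[of "g i" n "\<lambda>p. \<Sum>i\<in>I. c i * g i p" "c i" 1 p] schwartz_mod_sum[of I g n c] assms(2)
    by simp
qed (simp_all add: wbz_sum_def case_prod_unfold)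

text \<open>At fixed x = z and t = 0 the series of the difference \<open>d\<close> is a vanishing
  Fourier series in y, with coefficients d(z + k/n, k).\<close>

lemma inj_on_wbz_sum:
  assumes "n \<noteq> 0"
  shows "inj_on (wbz_sum n) (schwartz_mod n)"
proof
  fix g h assume gh: "g \<in> schwartz_mod n" "h \<in> schwartz_mod n" "wbz_sum n g = wbz_sum n h"
  define d where "d = (\<lambda>p. 1 * g p + (-1) * h p)"
  have d: "d \<in> schwartz_mod n" unfolding d_def by (intro schwartz_mod_lincomb gh)
  have 0: "wbz_sum n d p = 0" for p
    unfolding d_def by (subst wbz_sum_lincomb) (use gh assms in auto)
  have "d (x, k) = 0" for x k
  proof -
    \<comment> \<open>Each value d(x, k) is reached as the k-th coefficient over this base point,
      which depends on k.\<close>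
    define z where "z = x - of_int k / of_int n"
    have "d (z + of_int k / of_int n, k) = 0"
    proof (rule fourier_coeff_eq_0[where c = "\<lambda>k. d (z + of_int k / of_int n, k)"])
      show "(\<lambda>k. norm (d (z + of_int k / of_int n, k))) summable_on UNIV"
        using zak_series_summable(1)[OF zak_profile.base[OF d] assms] .
      show "(\<Sum>\<^sub>\<infinity>k. d (z + of_int k / of_int n, k) * exp (2 * of_real pi * \<i> * (of_int k * of_real y))) = 0" for y
        using 0[of "(z, y, 0)"] by (simp add: wbz_sum_def)
    qed
    thus ?thesis by (simp add: z_def)
  qed
  thus "g = h" by (auto simp: d_def fun_eq_iff)
qed

section \<open>The Heisenberg operators on Zak series\<close>

lemma partial_eq:
  assumes "(f has_derivative D) (at p)"
  shows "partial_x f p = D (1, 0, 0)" "partial_y f p = D (0, 1, 0)" "partial_t f p = D (0, 0, 1)"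
proof -
  obtain x y t where p: "p = (x, y, t)" by (cases p)
  interpret bounded_linear D using assms by (rule has_derivative_bounded_linear)
  have D: "D (v, 0, 0) = v *\<^sub>R D (1, 0, 0)" "D (0, v, 0) = v *\<^sub>R D (0, 1, 0)"
    "D (0, 0, v) = v *\<^sub>R D (0, 0, 1)" for v
    using scaleR[of v "(1, 0, 0)"] scaleR[of v "(0, 1, 0)"] scaleR[of v "(0, 0, 1)"] by simp_all
  have "((\<lambda>s. (s, y, t)) has_derivative (\<lambda>v. (v, 0, 0))) (at x)"
    "((\<lambda>s. (x, s, t)) has_derivative (\<lambda>v. (0, v, 0))) (at y)"
    "((\<lambda>s. (x, y, s)) has_derivative (\<lambda>v. (0, 0, v))) (at t)"
    by (auto intro!: derivative_eq_intros simp: zero_prod_def)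
  from this[THEN has_derivative_compose, OF assms[unfolded p]]
  have "((\<lambda>s. f (s, y, t)) has_vector_derivative D (1, 0, 0)) (at x)"
    "((\<lambda>s. f (x, s, t)) has_vector_derivative D (0, 1, 0)) (at y)"
    "((\<lambda>s. f (x, y, s)) has_vector_derivative D (0, 0, 1)) (at t)"
    unfolding has_vector_derivative_def D[symmetric] .
  thus "partial_x f p = D (1, 0, 0)" "partial_y f p = D (0, 1, 0)" "partial_t f p = D (0, 0, 1)"
    by (simp_all add: partial_x_def partial_y_def partial_t_def p vector_derivative_at)
qed

lemma partial_wbz_sum:
  assumes "g \<in> schwartz_mod n" "n \<noteq> 0"
  shows "partial_x (wbz_sum n g) p = wbz_sum n (partial_s g) p"
    and "partial_y (wbz_sum n g) p =
      2 * of_real pi * \<i> * zak_series n (\<lambda>x k. of_int k * g (x + of_int k / of_int n, k)) p"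
    and "partial_t (wbz_sum n g) p = 2 * of_real pi * \<i> * of_int n * wbz_sum n g p"
proof -
  note der = zak_series_has_derivative[OF zak_profile.base[OF assms(1)]
      zak_profile.base[OF schwartz_mod_partial_s[OF assms(1)]] zak_base_has_vderiv[OF assms(1)] assms(2), of p]
  have cm: "zak_series n (\<lambda>x k. c * G x k) p = c * zak_series n G p" for c G
    by (simp add: zak_series_def case_prod_unfold mult.assoc infsum_cmult_right')
  show "partial_x (wbz_sum n g) p = wbz_sum n (partial_s g) p"
    "partial_y (wbz_sum n g) p =
      2 * of_real pi * \<i> * zak_series n (\<lambda>x k. of_int k * g (x + of_int k / of_int n, k)) p"
    "partial_t (wbz_sum n g) p = 2 * of_real pi * \<i> * of_int n * wbz_sum n g p"
    using partial_eq[OF der] by (simp_all add: wbz_sum_eq_zak_series cm[symmetric] mult.assoc)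
qed

lemma heis_p_wbz_sum:
  assumes "g \<in> schwartz_mod n" "n \<noteq> 0"
  shows "heis_p (wbz_sum n g) = wbz_sum n (\<lambda>p. 1 / of_real (sqrt (2 * pi)) * partial_s g p)"
  unfolding wbz_sum_cmult heis_p_def fun_eq_iff using partial_wbz_sum(1)[OF assms] by auto

lemma heis_t_wbz_sum:
  assumes "g \<in> schwartz_mod n" "n \<noteq> 0"
  shows "heis_t (wbz_sum n g) p = of_int n * wbz_sum n g p"
  unfolding heis_t_def using partial_wbz_sum(3)[OF assms] by (cases p) auto

definition mult_s :: "(real \<times> int \<Rightarrow> complex) \<Rightarrow> real \<times> int \<Rightarrow> complex" where
  "mult_s g = (\<lambda>(x, k). of_real x * g (x, k))"

lemma schwartz_mod_mult_s: "g \<in> schwartz_mod n \<Longrightarrow> mult_s g \<in> schwartz_mod n"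
  by (auto simp: schwartz_mod_def mult_s_def schwartz_mult_id)

text \<open>The weights k from d/dy and n x from x d/dt add up to n (x + k/n), which is n times the
  point where the profile is evaluated. The constant is (-i / sqrt(2 pi)) 2 pi i = sqrt(2
  pi).\<close>

lemma heis_q_wbz_sum:
  assumes g: "g \<in> schwartz_mod n" and n: "n \<noteq> 0"
  shows "heis_q (wbz_sum n g) = wbz_sum n (\<lambda>p. (of_real (sqrt (2 * pi)) * of_int n) * mult_s g p)"
proof
  fix p :: point
  obtain x y t where p: "p = (x, y, t)" by (cases p)
  let ?G = "\<lambda>x k. g (x + of_int k / of_int n, k)"
  have G: "zak_profile n ?G" by (rule zak_profile.base[OF g])
  have "zak_profile n (\<lambda>x k. (0 + 1 * of_int k) * ?G x k + 0 * ?G x k)"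
    by (rule zak_profile.lincomb[OF G G])
  hence kG: "zak_profile n (\<lambda>x k. of_int k * ?G x k)" by simp
  \<comment> \<open>Here x is the first coordinate of the fixed point \<open>p\<close>, hence a
    scalar to which linearity applies; it is identified with the running variable x' only after
    evaluation at \<open>p\<close>.\<close>
  have "zak_series n (\<lambda>x k. of_int k * ?G x k) p + of_real x * of_int n * zak_series n ?G p =
      zak_series n (\<lambda>x' k. 1 * (of_int k * ?G x' k) + (of_real x * of_int n) * ?G x' k) p"
    by (subst zak_series_lincomb[OF kG G n]) simp
  also have "\<dots> = zak_series n (\<lambda>x' k. of_int n * mult_s g (x' + of_int k / of_int n, k)) p"
    unfolding zak_series_def p prod.case
    using n by (intro infsum_cong) (simp add: mult_s_def field_simps)
  also have "\<dots> = of_int n * wbz_sum n (mult_s g) p"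
    unfolding wbz_sum_eq_zak_series by (simp add: zak_series_def p mult.assoc infsum_cmult_right')
  finally have *: "zak_series n (\<lambda>x k. of_int k * ?G x k) p + of_real x * of_int n * wbz_sum n g p =
      of_int n * wbz_sum n (mult_s g) p" by (simp add: wbz_sum_eq_zak_series)
  have "heis_q (wbz_sum n g) p = - \<i> / of_real (sqrt (2 * pi)) * (2 * of_real pi * \<i>) *
     (zak_series n (\<lambda>x k. of_int k * ?G x k) p + of_real x * of_int n * wbz_sum n g p)"
    using partial_wbz_sum(2,3)[OF g n, of p] by (simp add: heis_q_def p algebra_simps)
  also have "- \<i> / of_real (sqrt (2 * pi)) * (2 * of_real pi * \<i>) = (of_real (sqrt (2 * pi)) :: complex)"
  proof -
    have "(of_real (sqrt (2 * pi)) :: complex) * of_real (sqrt (2 * pi)) = of_real (2 * pi)"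
      by (simp flip: of_real_mult)
    moreover have "(of_real (sqrt (2 * pi)) :: complex) \<noteq> 0" by simp
    ultimately show ?thesis by (simp add: field_simps del: of_real_sqrt)
  qed
  finally show "heis_q (wbz_sum n g) p = wbz_sum n (\<lambda>p. (of_real (sqrt (2 * pi)) * of_int n) * mult_s g p) p"
    unfolding * by (simp only: wbz_sum_cmult mult.assoc)
qed

lemma wbz_sum_in_heis_eig:
  assumes g: "g \<in> schwartz_mod n" and n: "n \<noteq> 0"
  shows "wbz_sum n g \<in> heis_eig n"
proof -
  have "smooth (wbz_sum n g)"
    unfolding wbz_sum_eq_zak_series by (rule smooth_zak_series[OF zak_profile.base[OF g] n])
  moreover have "wbz_sum n g (x, y + 1, t) = wbz_sum n g (x, y, t)" for x y t
    unfolding wbz_sum_def prod.case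
  proof (rule infsum_cong)
    fix k :: int
    have "of_int k * of_real (y + 1) + of_int n * of_real t =
        (of_int k * of_real y + of_int n * of_real t) + (of_int k :: complex)" by (simp add: algebra_simps)
    thus "g (x + of_int k / of_int n, k) * exp (2 * of_real pi * \<i> * (of_int k * of_real (y + 1) + of_int n * of_real t)) =
      g (x + of_int k / of_int n, k) * exp (2 * of_real pi * \<i> * (of_int k * of_real y + of_int n * of_real t))"
      by (simp only: exp_2pi_i_add_int)
  qed
  moreover have "wbz_sum n g (x, y, t + 1) = wbz_sum n g (x, y, t)" for x y t
    unfolding wbz_sum_def prod.case
  proof (rule infsum_cong)
    fix k :: int
    have "of_int k * of_real y + of_int n * of_real (t + 1) =
        (of_int k * of_real y + of_int n * of_real t) + (of_int n :: complex)" by (simp add: algebra_simps)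
    thus "g (x + of_int k / of_int n, k) * exp (2 * of_real pi * \<i> * (of_int k * of_real y + of_int n * of_real (t + 1))) =
      g (x + of_int k / of_int n, k) * exp (2 * of_real pi * \<i> * (of_int k * of_real y + of_int n * of_real t))"
      by (simp only: exp_2pi_i_add_int)
  qed
  moreover have "wbz_sum n g (x + 1, y, t + y) = wbz_sum n g (x, y, t)" for x y t
  proof -
    \<comment> \<open>The k-th term at (x + 1, y, t + y) is the term of index k + n at (x, y, t):
      the argument is x + (k + n)/n, the phase gains n y, and \<open>g\<close> is n-periodic in
      k.\<close>
    have "bij_betw (\<lambda>k. k + n) UNIV UNIV" by (rule bij_betwI[where g = "\<lambda>k. k - n"]) auto
    note infsum_reindex_bij_betw[OF this, of "\<lambda>k. g (x + of_int k / of_int n, k) *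
       exp (2 * of_real pi * \<i> * (of_int k * of_real y + of_int n * of_real t))", symmetric]
    moreover have "g (x + of_int (k + n) / of_int n, k + n) = g (x + 1 + of_int k / of_int n, k)" for k
      using schwartz_mod_periodic[OF g, of _ k 1] n by (simp add: add_divide_distrib add_ac)
    ultimately show ?thesis
      unfolding wbz_sum_def prod.case by (simp add: algebra_simps)
  qed
  ultimately show ?thesis
    using heis_t_wbz_sum[OF g n] by (simp add: heis_eig_def heis_alg_def)
qed

text \<open>Injectivity makes the description unique, and membership in \<open>heis_eig n\<close>
  places the argument inside the domain of the restricted map.\<close>

lemma wbz_wbz_sum:
  assumes "g \<in> schwartz_mod n" "n \<noteq> 0"
  shows "wbz n (wbz_sum n g) = g"
proof -
  have "(THE h. h \<in> schwartz_mod n \<and> wbz_sum n g = wbz_sum n h) = g"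
    by (rule the_equality) (use assms inj_onD[OF inj_on_wbz_sum[OF assms(2)]] in auto)
  thus ?thesis by (simp add: wbz_def wbz_sum_in_heis_eig[OF assms])
qed

section \<open>Multiplication by U and V on transforms\<close>

definition shift_U :: "int \<Rightarrow> (real \<times> int \<Rightarrow> complex) \<Rightarrow> real \<times> int \<Rightarrow> complex" where
  "shift_U n g = (\<lambda>(x, k). g (x - 1 / of_int n, k - 1))"

definition mult_V :: "int \<Rightarrow> (real \<times> int \<Rightarrow> complex) \<Rightarrow> real \<times> int \<Rightarrow> complex" where
  "mult_V n g = (\<lambda>(x, k). exp (2 * of_real pi * \<i> * (of_real x - of_int k / of_int n)) * g (x, k))"

lemma schwartz_mod_shift_U:
  assumes "g \<in> schwartz_mod n"
  shows "shift_U n g \<in> schwartz_mod n"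
proof -
  have "g (x, k + n - 1) = g (x, k - 1)" for x k
    using schwartz_mod_periodic[OF assms, of x "k - 1" 1] by (simp add: algebra_simps)
  moreover have "(\<lambda>x. g (x - 1 / of_int n, k - 1)) \<in> schwartz" for k
    by (rule schwartz_translate[OF schwartz_mod_D[OF assms]])
  ultimately show ?thesis by (simp add: schwartz_mod_def shift_U_def)
qed

lemma schwartz_mod_mult_V:
  assumes "g \<in> schwartz_mod n" "n \<noteq> 0"
  shows "mult_V n g \<in> schwartz_mod n"
proof -
  have "exp (2 * of_real pi * \<i> * (of_real x - of_int (k + n) / of_int n)) =
      exp (2 * of_real pi * \<i> * (of_real x - of_int k / of_int n))" for x k
  proof -
    have "of_real x - of_int (k + n) / of_int n = (of_real x - of_int k / of_int n) + (of_int (-1) :: complex)"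
      using assms(2) by (simp add: field_simps)
    thus ?thesis by (simp only: exp_2pi_i_add_int)
  qed
  moreover have "g (x, k + n) = g (x, k)" for x k
    using schwartz_mod_periodic[OF assms(1), of x k 1] by simp
  ultimately show ?thesis
    using schwartz_mult_exp[OF schwartz_mod_D[OF assms(1)]] by (simp add: schwartz_mod_def mult_V_def)
qed

text \<open>The factor e(y) moves the frequency k to k + 1. The coefficient keeps its argument x +
  k/n = (x + (k + 1)/n) - 1/n, whence the translation by 1/n.\<close>

lemma torus_U_mult_wbz_sum: "torus_U p * wbz_sum n g p = wbz_sum n (shift_U n g) p"
proof -
  obtain x y t where p: "p = (x, y, t)" by (cases p)
  have b: "bij_betw (\<lambda>k. k + 1) UNIV (UNIV :: int set)" by (rule bij_betwI[where g = "\<lambda>k. k - 1"]) auto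
  have "wbz_sum n (shift_U n g) p = (\<Sum>\<^sub>\<infinity>k. shift_U n g (x + of_int (k + 1) / of_int n, k + 1) *
     exp (2 * of_real pi * \<i> * (of_int (k + 1) * of_real y + of_int n * of_real t)))"
    unfolding wbz_sum_def p prod.case
    by (subst infsum_reindex_bij_betw[OF b, symmetric]) simp
  also have "\<dots> = (\<Sum>\<^sub>\<infinity>k. torus_U p * (g (x + of_int k / of_int n, k) *
     exp (2 * of_real pi * \<i> * (of_int k * of_real y + of_int n * of_real t))))"
    by (rule infsum_cong)
       (simp add: shift_U_def torus_U_def p add_divide_distrib algebra_simps exp_add[symmetric])
  also have "\<dots> = torus_U p * wbz_sum n g p"
    by (simp add: infsum_cmult_right' wbz_sum_def p)
  finally show ?thesis ..
qed

text \<open>The profile of index k is evaluated at s = x + k/n, in terms of which e(x) is e(s -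
  k/n).\<close>

lemma torus_V_mult_wbz_sum: "torus_V p * wbz_sum n g p = wbz_sum n (mult_V n g) p"
proof -
  obtain x y t where p: "p = (x, y, t)" by (cases p)
  have "wbz_sum n (mult_V n g) p = (\<Sum>\<^sub>\<infinity>k. torus_V p * (g (x + of_int k / of_int n, k) *
     exp (2 * of_real pi * \<i> * (of_int k * of_real y + of_int n * of_real t))))"
    unfolding wbz_sum_def p prod.case
    by (rule infsum_cong) (simp add: mult_V_def torus_V_def)
  thus ?thesis by (simp add: infsum_cmult_right' wbz_sum_def p)
qed

section \<open>Formal power series and the module actions\<close>

text \<open>Convergence in the \<nu>-adic topology means that every coefficient is eventually
  constant. The j-th term has order at least j, so coefficient N is settled by the terms up to j =
  N.\<close>

lemma fps_nth_suminf:
  fixes T :: "nat \<Rightarrow> complex fps"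
  assumes "\<And>j m. m < j \<Longrightarrow> fps_nth (T j) m = 0"
  shows "fps_nth (suminf T) N = (\<Sum>j\<le>N. fps_nth (T j) N)"
proof -
  have T: "T sums Abs_fps (\<lambda>N. \<Sum>j\<le>N. fps_nth (T j) N)"
    unfolding sums_def tendsto_fps_iff
  proof
    fix N
    have "fps_nth (\<Sum>j<M. T j) N = (\<Sum>j\<le>N. fps_nth (T j) N)" if "M \<ge> Suc N" for M
      unfolding fps_sum_nth using that assms
      by (intro sum.mono_neutral_right) auto
    thus "\<forall>\<^sub>F M in sequentially. fps_nth (\<Sum>j<M. T j) N =
        fps_nth (Abs_fps (\<lambda>N. \<Sum>j\<le>N. fps_nth (T j) N)) N"
      unfolding eventually_sequentially fps_nth_Abs_fps by blast
  qed
  show ?thesis unfolding sums_unique[OF T, symmetric] by simp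
qed

lemma fps_nth_mult_eq_0:
  fixes c :: "complex fps"
  assumes "\<And>m. m < j \<Longrightarrow> fps_nth c m = 0" "m < j"
  shows "fps_nth (c * A) m = 0"
  using assms by (auto simp: fps_mult_nth intro!: sum.neutral)

lemma fps_suminf_mult:
  fixes T :: "nat \<Rightarrow> complex fps"
  assumes T: "\<And>j m. m < j \<Longrightarrow> fps_nth (T j) m = 0"
  shows "(\<Sum>j. T j * A) = (\<Sum>j. T j) * A"
proof (rule fps_ext)
  fix N
  have "fps_nth (T j * A) m = 0" if "m < j" for j m
    using T that by (rule fps_nth_mult_eq_0)
  hence "fps_nth (\<Sum>j. T j * A) N = (\<Sum>j\<le>N. \<Sum>i=0..N. fps_nth (T j) i * fps_nth A (N - i))"
    by (subst fps_nth_suminf) (simp_all add: fps_mult_nth)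
  also have "\<dots> = (\<Sum>i=0..N. \<Sum>j\<le>N. fps_nth (T j) i * fps_nth A (N - i))"
    by (rule sum.swap)
  \<comment> \<open>The terms with i < j \<le> N vanish because \<open>T j\<close> has order at
    least j.\<close>
  also have "\<dots> = (\<Sum>i=0..N. (\<Sum>j\<le>i. fps_nth (T j) i) * fps_nth A (N - i))"
    unfolding sum_distrib_right
    by (intro sum.cong refl sum.mono_neutral_right) (auto simp: T)
  also have "\<dots> = fps_nth ((\<Sum>j. T j) * A) N"
    by (simp add: fps_mult_nth fps_nth_suminf[OF T])
  finally show "fps_nth (\<Sum>j. T j * A) N = fps_nth ((\<Sum>j. T j) * A) N" .
qed

lemma Theta_power_nth:
  assumes "\<theta> \<in> Theta" "m < j"
  shows "fps_nth (\<theta> ^ j) m = 0"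
  using assms startsby_zero_power_prefix by (auto simp: Theta_def)

lemma formal_exp_eq_suminf:
  assumes "\<theta> \<in> Theta"
  shows "formal_exp c \<theta> = (\<Sum>j. fps_const (c ^ j / fact j) * \<theta> ^ j)"
proof (rule fps_ext)
  fix N
  show "fps_nth (formal_exp c \<theta>) N = fps_nth (\<Sum>j. fps_const (c ^ j / fact j) * \<theta> ^ j) N"
    by (subst fps_nth_suminf)
       (auto simp: Theta_power_nth[OF assms] formal_exp_def fps_compose_nth atLeast0AtMost)
qed

lemma fcoeff_coeffwise: "fcoeff (coeffwise D F) N = D (fcoeff F N)"
  by (simp add: fcoeff_def coeffwise_def)

lemma fps_nth_coeffwise: "fps_nth (coeffwise D F p) N = D (fcoeff F N) p"
  by (simp add: coeffwise_def)

text \<open>The coefficients of positive degree of \<open>fconst a\<close> are zero functions, which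
  \<open>D\<close> has to send to zero; \<open>D\<close> is not assumed linear.\<close>

lemma coeffwise_fconst:
  assumes "D (\<lambda>p. 0) = (\<lambda>p. 0)"
  shows "coeffwise D (fconst a) = fconst (D a)"
proof (intro ext fps_ext)
  fix p N
  have "fcoeff (fconst a) N = (if N = 0 then a else (\<lambda>p. 0))" by (auto simp: fcoeff_def fconst_def)
  thus "fps_nth (coeffwise D (fconst a) p) N = fps_nth (fconst (D a) p) N"
    using assms by (simp add: coeffwise_def fconst_def)
qed

text \<open>Since \<open>c j\<close> has order at least j, every coefficient of the sum is a finite
  linear combination of functions in \<open>schwartz_mod n\<close>, and \<open>wbz_sum\<close> is
  linear on those.\<close>

lemma coeffwise_wbz_sum_suminf:
  assumes n: "n \<noteq> 0"
    and c: "\<And>j m. m < j \<Longrightarrow> fps_nth (c j) m = 0"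
    and G: "\<And>j. G j \<in> series_over (schwartz_mod n)"
  shows "(\<lambda>q. \<Sum>j. c j * G j q) \<in> series_over (schwartz_mod n)"
    and "coeffwise (wbz_sum n) (\<lambda>q. \<Sum>j. c j * G j q) = (\<lambda>p. \<Sum>j. c j * coeffwise (wbz_sum n) (G j) p)"
proof -
  \<comment> \<open>The pair (j, i) selects degree i from \<open>c j\<close> and degree N - i from
    \<open>G j\<close>.\<close>
  define C where "C = (\<lambda>(j, i). fps_nth (c j) i)"
  define H where "H = (\<lambda>N (j, i). fcoeff (G j) (N - i))"
  have H: "H N ji \<in> schwartz_mod n" for N ji
    using G by (auto simp: H_def series_over_def split: prod.split)
  have nth: "fps_nth (\<Sum>j. c j * A j) N = (\<Sum>(j, i)\<in>{..N} \<times> {0..N}. fps_nth (c j) i * fps_nth (A j) (N - i))"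
    for A N
  proof -
    have "fps_nth (c j * A j) m = 0" if "m < j" for j m
      using c that by (rule fps_nth_mult_eq_0)
    thus ?thesis by (subst fps_nth_suminf) (simp_all add: fps_mult_nth sum.cartesian_product)
  qed
  have coeff: "fcoeff (\<lambda>q. \<Sum>j. c j * G j q) N = (\<lambda>q. \<Sum>ji\<in>{..N} \<times> {0..N}. C ji * H N ji q)" for N
    by (simp add: fcoeff_def nth C_def H_def case_prod_unfold)
  show "(\<lambda>q. \<Sum>j. c j * G j q) \<in> series_over (schwartz_mod n)"
    unfolding series_over_def mem_Collect_eq coeff using H by (intro allI schwartz_mod_sum)
  show "coeffwise (wbz_sum n) (\<lambda>q. \<Sum>j. c j * G j q) = (\<lambda>p. \<Sum>j. c j * coeffwise (wbz_sum n) (G j) p)"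
  proof (intro ext fps_ext)
    fix p N
    have "fps_nth (coeffwise (wbz_sum n) (\<lambda>q. \<Sum>j. c j * G j q) p) N =
        (\<Sum>ji\<in>{..N} \<times> {0..N}. C ji * wbz_sum n (H N ji) p)"
      using wbz_sum_sum[OF H n] by (simp add: coeffwise_def coeff)
    thus "fps_nth (coeffwise (wbz_sum n) (\<lambda>q. \<Sum>j. c j * G j q) p) N =
        fps_nth (\<Sum>j. c j * coeffwise (wbz_sum n) (G j) p) N"
      by (simp add: nth C_def H_def coeffwise_def case_prod_unfold)
  qed
qed

section \<open>Transforming back, and the common form of the four actions\<close>

lemma coeffwise_wbz_wbz_sum:
  assumes "n \<noteq> 0" "F \<in> series_over (schwartz_mod n)"
  shows "coeffwise (wbz n) (coeffwise (wbz_sum n) F) = F"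
proof (intro ext fps_ext)
  fix p N
  have "wbz n (wbz_sum n (fcoeff F N)) = fcoeff F N"
    using assms by (intro wbz_wbz_sum) (auto simp: series_over_def)
  thus "fps_nth (coeffwise (wbz n) (coeffwise (wbz_sum n) F) p) N = fps_nth (F p) N"
    by (simp add: coeffwise_def[of "wbz n"] fcoeff_coeffwise) (simp add: fcoeff_def)
qed

text \<open>The eigenvector equation is assumed for every multiple of \<open>a\<close>, which
  supplies the homogeneity of \<open>D\<close> that iteration uses.\<close>

lemma funpow_eigen:
  fixes D :: "('a \<Rightarrow> complex) \<Rightarrow> 'a \<Rightarrow> complex"
  assumes "\<And>c. D (\<lambda>p. c * a p) = (\<lambda>p. c * b * a p)"
  shows "(D ^^ j) (\<lambda>p. c * a p) = (\<lambda>p. c * b ^ j * a p)"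
proof (induction j)
  case (Suc j)
  thus ?case using assms[of "c * b ^ j"] by (simp add: mult_ac)
qed simp

lemma funpow_wbz_sum:
  assumes S: "\<And>g. g \<in> schwartz_mod n \<Longrightarrow> d g \<in> schwartz_mod n"
    and D: "\<And>g. g \<in> schwartz_mod n \<Longrightarrow> D (wbz_sum n g) = wbz_sum n (\<lambda>p. \<alpha> * d g p)"
    and cm: "\<And>g c. g \<in> schwartz_mod n \<Longrightarrow> d (\<lambda>p. c * g p) = (\<lambda>p. c * d g p)"
    and g: "g \<in> schwartz_mod n"
  shows "(d ^^ j) g \<in> schwartz_mod n"
    and "(D ^^ j) (wbz_sum n g) = wbz_sum n (\<lambda>p. \<alpha> ^ j * (d ^^ j) g p)"
proof -
  show *: "(d ^^ j) g \<in> schwartz_mod n" for j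
    by (induction j) (use S g in auto)
  show "(D ^^ j) (wbz_sum n g) = wbz_sum n (\<lambda>p. \<alpha> ^ j * (d ^^ j) g p)"
  proof (induction j)
    case (Suc j)
    show ?case
      using D[OF schwartz_mod_cmult[OF *], of "\<alpha> ^ j" j] cm[OF *, of "\<alpha> ^ j" j]
      by (simp add: Suc mult.assoc)
  qed simp
qed

text \<open>All four actions are instances: \<open>D\<close> and \<open>D'\<close> are \<open>heis_p\<close> and \<open>heis_q\<close> in either
  order, \<open>\<alpha> d\<close> is what \<open>D\<close> becomes on transforms, \<open>b\<close> is the eigenvalue of \<open>a\<close> under \<open>D'\<close>,
  and \<open>m\<close> is multiplication by \<open>a\<close> on transforms.\<close>

lemma wbz_star_action:
  assumes n: "n \<noteq> 0" and \<theta>: "\<theta> \<in> Theta" and F: "F \<in> series_over (schwartz_mod n)"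
    and dS: "\<And>g. g \<in> schwartz_mod n \<Longrightarrow> d g \<in> schwartz_mod n"
    and D: "\<And>g. g \<in> schwartz_mod n \<Longrightarrow> D (wbz_sum n g) = wbz_sum n (\<lambda>p. \<alpha> * d g p)"
    and cm: "\<And>g c. g \<in> schwartz_mod n \<Longrightarrow> d (\<lambda>p. c * g p) = (\<lambda>p. c * d g p)"
    and a: "\<And>c. D' (\<lambda>p. c * a p) = (\<lambda>p. c * b * a p)"
    and mS: "\<And>g. g \<in> schwartz_mod n \<Longrightarrow> m g \<in> schwartz_mod n"
    and m: "\<And>g p. g \<in> schwartz_mod n \<Longrightarrow> a p * wbz_sum n g p = wbz_sum n (m g) p"
  shows "coeffwise (wbz n) (\<lambda>p. \<Sum>j. fps_const (1 / fact j) * (- \<theta>) ^ j *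
      (coeffwise (D' ^^ j) (fconst a) p * coeffwise (D ^^ j) (coeffwise (wbz_sum n) F) p)) =
    (\<lambda>q. \<Sum>j. fps_const ((b * \<alpha>) ^ j / fact j) * (- \<theta>) ^ j * coeffwise (\<lambda>g. m ((d ^^ j) g)) F q)"
proof -
  let ?c = "\<lambda>j. fps_const ((b * \<alpha>) ^ j / fact j) * (- \<theta>) ^ j"
  let ?G = "\<lambda>j. coeffwise (\<lambda>g. m ((d ^^ j) g)) F"
  have Fc: "fcoeff F N \<in> schwartz_mod n" for N using F by (simp add: series_over_def)
  have iter: "(d ^^ j) g \<in> schwartz_mod n"
    "(D ^^ j) (wbz_sum n g) = wbz_sum n (\<lambda>p. \<alpha> ^ j * (d ^^ j) g p)"
    if "g \<in> schwartz_mod n" for g j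
    by (rule funpow_wbz_sum[where D = D and d = d and n = n]; use dS D cm that in blast)+
  have "- \<theta> \<in> Theta" using \<theta> by (simp add: Theta_def)
  hence c0: "fps_nth (?c j) k = 0" if "k < j" for j k
    using Theta_power_nth that by simp
  have G: "?G j \<in> series_over (schwartz_mod n)" for j
    unfolding series_over_def mem_Collect_eq fcoeff_coeffwise using mS iter(1) Fc by blast
  \<comment> \<open>The factor \<open>a\<close> contributes b^j and its own value, the Zak series
    contributes \<alpha>^j and d^j; the remaining multiplication by \<open>a\<close> becomes
    \<open>m\<close> on transforms.\<close>
  have *: "coeffwise (D' ^^ j) (fconst a) p * coeffwise (D ^^ j) (coeffwise (wbz_sum n) F) p =
      fps_const ((b * \<alpha>) ^ j) * coeffwise (wbz_sum n) (?G j) p" for j p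
  proof (rule fps_ext)
    fix N
    \<comment> \<open>The multiple c = 0 of the eigenvector provides the condition of
      \<open>coeffwise_fconst\<close>.\<close>
    have "(D' ^^ j) (\<lambda>p. 0) = (\<lambda>p. 0)" using funpow_eigen[where D = D', OF a, of j 0] by simp
    hence "coeffwise (D' ^^ j) (fconst a) = fconst (\<lambda>p. b ^ j * a p)"
      using funpow_eigen[where D = D', OF a, of j 1] by (simp add: coeffwise_fconst)
    moreover have "(D ^^ j) (wbz_sum n (fcoeff F N)) p = \<alpha> ^ j * wbz_sum n ((d ^^ j) (fcoeff F N)) p"
      using iter(2)[OF Fc] by (simp add: wbz_sum_cmult)
    ultimately show "fps_nth (coeffwise (D' ^^ j) (fconst a) p * coeffwise (D ^^ j) (coeffwise (wbz_sum n) F) p) N =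
        fps_nth (fps_const ((b * \<alpha>) ^ j) * coeffwise (wbz_sum n) (?G j) p) N"
      using m[OF iter(1)[OF Fc], of p j N]
      by (simp add: fconst_def fps_nth_coeffwise fcoeff_coeffwise power_mult_distrib mult_ac)
  qed
  have "(\<lambda>p. \<Sum>j. fps_const (1 / fact j) * (- \<theta>) ^ j *
      (coeffwise (D' ^^ j) (fconst a) p * coeffwise (D ^^ j) (coeffwise (wbz_sum n) F) p)) =
      (\<lambda>p. \<Sum>j. ?c j * coeffwise (wbz_sum n) (?G j) p)"
  proof -
    have "fps_const ((b * \<alpha>) ^ j / fact j) = fps_const (1 / fact j) * fps_const ((b * \<alpha>) ^ j)" for j
      by simp
    thus ?thesis unfolding * by (simp only: mult_ac)
  qed
  also have "\<dots> = coeffwise (wbz_sum n) (\<lambda>q. \<Sum>j. ?c j * ?G j q)"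
    by (rule coeffwise_wbz_sum_suminf(2)[OF n c0 G, symmetric])
  finally show ?thesis
    using coeffwise_wbz_wbz_sum[OF n coeffwise_wbz_sum_suminf(1)[OF n c0 G]] by simp
qed

section \<open>Iterated operators on transforms, and U and V as eigenvectors\<close>

lemma partial_s_cmult:
  assumes "g \<in> schwartz_mod n"
  shows "partial_s (\<lambda>p. c * g p) = (\<lambda>p. c * partial_s g p)"
proof
  fix p :: "real \<times> int"
  obtain x k where p: "p = (x, k)" by (cases p)
  show "partial_s (\<lambda>p. c * g p) p = c * partial_s g p"
    unfolding p by (subst partial_s_def, unfold prod.case, intro vector_derivative_at
        has_vector_derivative_mult_right schwartz_mod_has_vderiv[OF assms])
qed

lemma mult_s_cmult: "mult_s (\<lambda>p. c * g p) = (\<lambda>p. c * mult_s g p)"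
  by (auto simp: mult_s_def)

lemma funpow_partial_s: "(partial_s ^^ j) g (x, k) = (vderiv ^^ j) (\<lambda>s. g (s, k)) x"
proof (induction j arbitrary: x)
  case (Suc j)
  have "partial_s h (x, k) = vderiv (\<lambda>s. h (s, k)) x" for h by (simp add: partial_s_def)
  thus ?case by (simp add: Suc)
qed simp

lemma funpow_mult_s: "(mult_s ^^ j) g (x, k) = of_real x ^ j * g (x, k)"
  by (induction j) (simp_all add: mult_s_def mult.assoc)

lemma vector_derivative_exp_2pi_i:
  "vector_derivative (\<lambda>s. c * exp (2 * of_real pi * \<i> * of_real s)) (at x) =
    c * (2 * of_real pi * \<i>) * exp (2 * of_real pi * \<i> * of_real x)"
  by (intro vector_derivative_at has_vector_derivative_real_field) (auto intro!: derivative_eq_intros)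

lemma partial_torus:
  "partial_x (\<lambda>p. c * torus_U p) p = 0"
  "partial_y (\<lambda>p. c * torus_U p) p = c * (2 * of_real pi * \<i>) * torus_U p"
  "partial_t (\<lambda>p. c * torus_U p) p = 0"
  "partial_x (\<lambda>p. c * torus_V p) p = c * (2 * of_real pi * \<i>) * torus_V p"
  "partial_y (\<lambda>p. c * torus_V p) p = 0"
  "partial_t (\<lambda>p. c * torus_V p) p = 0"
  by (cases p; simp add: partial_x_def partial_y_def partial_t_def torus_U_def torus_V_def
      vector_derivative_exp_2pi_i)+

lemma two_pi_eq: "2 * of_real pi = (of_real (sqrt (2 * pi)) * of_real (sqrt (2 * pi)) :: complex)"
proof -
  have "(of_real (sqrt (2 * pi)) * of_real (sqrt (2 * pi)) :: complex) = of_real (sqrt (2 * pi) * sqrt (2 * pi))"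
    by (rule of_real_mult[symmetric])
  thus ?thesis by simp
qed

text \<open>The right-hand sides keep the form c b a(p), even for b = 0, so that they match the
  eigenvector hypothesis of \<open>wbz_star_action\<close>. The equations for \<open>heis_t\<close>
  place U and V in \<open>heis_eig 0\<close>.\<close>

lemma heis_torus:
  shows "heis_p (\<lambda>p. c * torus_U p) = (\<lambda>p. c * 0 * torus_U p)"
    and "heis_q (\<lambda>p. c * torus_U p) = (\<lambda>p. c * of_real (sqrt (2 * pi)) * torus_U p)"
    and "heis_p (\<lambda>p. c * torus_V p) = (\<lambda>p. c * (of_real (sqrt (2 * pi)) * \<i>) * torus_V p)"
    and "heis_q (\<lambda>p. c * torus_V p) = (\<lambda>p. c * 0 * torus_V p)"
    and "heis_t torus_U = (\<lambda>p. 0)" and "heis_t torus_V = (\<lambda>p. 0)"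
proof -
  define s where "s = (of_real (sqrt (2 * pi)) :: complex)"
  have s: "s \<noteq> 0" "2 * of_real pi = s * s" unfolding s_def by simp (rule two_pi_eq)
  \<comment> \<open>With s s = 2 pi, the eigenvalue 2 pi i of the derivative becomes s under the
    factor -i/s and s i under the factor 1/s.\<close>
  have *: "- (\<i> / s * (c * (2 * of_real pi * \<i>) * u)) = c * s * u"
    "1 / s * (c * (2 * of_real pi * \<i>) * u) = c * (s * \<i>) * u" for u
    unfolding s(2) using s(1) by (simp_all add: field_simps)
  show "heis_p (\<lambda>p. c * torus_U p) = (\<lambda>p. c * 0 * torus_U p)"
    "heis_q (\<lambda>p. c * torus_U p) = (\<lambda>p. c * of_real (sqrt (2 * pi)) * torus_U p)"
    "heis_p (\<lambda>p. c * torus_V p) = (\<lambda>p. c * (of_real (sqrt (2 * pi)) * \<i>) * torus_V p)"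
    "heis_q (\<lambda>p. c * torus_V p) = (\<lambda>p. c * 0 * torus_V p)"
    "heis_t torus_U = (\<lambda>p. 0)" "heis_t torus_V = (\<lambda>p. 0)"
    unfolding heis_p_def heis_q_def heis_t_def s_def[symmetric] partial_torus
    using partial_torus(3,6)[of 1] by (auto simp: fun_eq_iff * simp del: times_divide_eq_left)
qed

text \<open>A derivative in direction v multiplies the exponential by the constant 2 pi i l(v), so
  its scalar multiples form a class closed under directional derivatives.\<close>

lemma smooth_exp_linear:
  assumes "bounded_linear (l :: 'a::real_normed_vector \<Rightarrow> real)"
  shows "smooth (\<lambda>p. exp (2 * of_real pi * \<i> * of_real (l p)))"
proof (rule smooth_coinduct[where X = "\<lambda>f. \<exists>c. f = (\<lambda>p. c * exp (2 * of_real pi * \<i> * of_real (l p)))"])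
  show "\<exists>c. (\<lambda>p. exp (2 * of_real pi * \<i> * of_real (l p))) = (\<lambda>p. c * exp (2 * of_real pi * \<i> * of_real (l p)))"
    by (intro exI[of _ 1]) simp
  have der: "((\<lambda>p. c * exp (2 * of_real pi * \<i> * of_real (l p))) has_derivative
      (\<lambda>v. c * (exp (2 * of_real pi * \<i> * of_real (l p)) * (2 * of_real pi * \<i> * of_real (l v))))) (at p)" for c p
  proof -
    have "((\<lambda>p. 2 * of_real pi * \<i> * of_real (l p)) has_derivative (\<lambda>v. 2 * of_real pi * \<i> * of_real (l v))) (at p)"
      by (intro has_derivative_mult_right has_derivative_of_real bounded_linear_imp_has_derivative assms)
    from has_derivative_compose[OF this DERIV_exp[unfolded has_field_derivative_def]]
    show ?thesis by (rule has_derivative_mult_right)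
  qed
  fix f assume "\<exists>c. f = (\<lambda>p. c * exp (2 * of_real pi * \<i> * of_real (l p)))"
  then obtain c where f: "f = (\<lambda>p. c * exp (2 * of_real pi * \<i> * of_real (l p)))" by blast
  show "f differentiable (at p)" for p
    unfolding f differentiable_def using der by blast
  fix v
  have "frechet_derivative f (at p) v = (c * (2 * of_real pi * \<i> * of_real (l v))) *
      exp (2 * of_real pi * \<i> * of_real (l p))" for p
    unfolding f frechet_derivative_at[OF der, symmetric] by (simp only: mult_ac)
  thus "\<exists>c. (\<lambda>p. frechet_derivative f (at p) v) = (\<lambda>p. c * exp (2 * of_real pi * \<i> * of_real (l p)))"
    by blast
qed

lemma torus_in_heis_eig: "torus_U \<in> heis_eig 0" "torus_V \<in> heis_eig 0"
proof -
  have "bounded_linear (\<lambda>p::point. fst (snd p))"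
    by (rule bounded_linear_compose[OF bounded_linear_fst bounded_linear_snd, unfolded o_def])
  hence "smooth torus_U" using smooth_exp_linear by (simp add: torus_U_def case_prod_unfold)
  moreover have "smooth torus_V"
    using smooth_exp_linear[OF bounded_linear_fst] by (simp add: torus_V_def case_prod_unfold)
  moreover have "exp (2 * of_real pi * \<i> * (of_real x + 1)) = exp (2 * of_real pi * \<i> * of_real x)" for x
    using exp_2pi_i_add_int[of "of_real x" 1] by simp
  ultimately show "torus_U \<in> heis_eig 0" "torus_V \<in> heis_eig 0"
    by (auto simp: heis_eig_def heis_alg_def heis_torus) (simp_all add: torus_U_def torus_V_def)
qed

text \<open>Since 0^0 = 1, exactly the term j = 0 survives. This settles the two actions where the
  eigenvalue is 0.\<close>

lemma suminf_power_0:
  fixes T :: "nat \<Rightarrow> complex fps"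
  shows "(\<Sum>j. fps_const (0 ^ j / fact j) * T j) = T 0"
  by (subst suminf_finite[of "{0}"]) auto

theorem mainTheorem4:
  fixes n :: int and \<theta> \<theta>' :: "complex fps"
  assumes "n \<noteq> 0" and "\<theta> \<in> Theta" and "\<theta>' \<in> Theta"
  shows "torus_U \<in> heis_eig 0 \<and> torus_V \<in> heis_eig 0 \<and>
    (\<forall>F \<in> series_over (schwartz_mod n). \<forall>(x::real) (k::int).
       left_act n \<theta>' torus_U F (x, k) = F (x - 1 / of_int n, k - 1) \<and>
       right_act n \<theta> F torus_U (x, k) =
         formal_shift (- \<theta>) (\<lambda>s. F (s, k - 1)) (x - 1 / of_int n) \<and>
       left_act n \<theta>' torus_V F (x, k) =
         fps_const (exp (2 * of_real pi * \<i> * (of_real x - of_int k / of_int n))) *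
         formal_exp (- 2 * of_real pi * \<i> * of_int n * of_real x) \<theta>' * F (x, k) \<and>
       right_act n \<theta> F torus_V (x, k) =
         fps_const (exp (2 * of_real pi * \<i> * (of_real x - of_int k / of_int n))) * F (x, k))"
proof (intro conjI ballI allI torus_in_heis_eig)
  fix F and x :: real and k :: int
  assume F: "F \<in> series_over (schwartz_mod n)"
  let ?s = "of_real (sqrt (2 * pi)) :: complex"
  let ?e = "exp (2 * of_real pi * \<i> * (of_real x - of_int k / of_int n)) :: complex"
  note n = assms(1)
  have left: "left_act n \<theta>' a F = coeffwise (wbz n) (\<lambda>p. \<Sum>j. fps_const (1 / fact j) * (- \<theta>') ^ j *
      (coeffwise (heis_p ^^ j) (fconst a) p * coeffwise (heis_q ^^ j) (coeffwise (wbz_sum n) F) p))" for a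
    by (simp add: left_act_def star_def mult.assoc)
  \<comment> \<open>Pointwise commutativity puts the factor of \<open>a\<close> first, as
    \<open>wbz_star_action\<close> expects; \<open>heis_q\<close> then takes the place of
    \<open>D'\<close>.\<close>
  have right: "right_act n \<theta> F a = coeffwise (wbz n) (\<lambda>p. \<Sum>j. fps_const (1 / fact j) * (- \<theta>) ^ j *
      (coeffwise (heis_q ^^ j) (fconst a) p * coeffwise (heis_p ^^ j) (coeffwise (wbz_sum n) F) p))" for a
    by (simp add: right_act_def star_def mult.assoc mult.commute[of "coeffwise (heis_q ^^ _) _ _"])

  have "left_act n \<theta>' torus_U F = (\<lambda>q. \<Sum>j. fps_const ((0 * (?s * of_int n)) ^ j / fact j) * (- \<theta>') ^ j *
      coeffwise (\<lambda>g. shift_U n ((mult_s ^^ j) g)) F q)"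
    unfolding left
    by (intro wbz_star_action heis_torus(1) schwartz_mod_shift_U torus_U_mult_wbz_sum
        schwartz_mod_mult_s heis_q_wbz_sum mult_s_cmult assms F)
  hence "left_act n \<theta>' torus_U F (x, k) = coeffwise (shift_U n) F (x, k)"
    by (simp add: mult.assoc suminf_power_0 del: of_real_sqrt)
  also have "\<dots> = F (x - 1 / of_int n, k - 1)"
    by (rule fps_ext) (simp add: coeffwise_def shift_U_def fcoeff_def)
  finally show "left_act n \<theta>' torus_U F (x, k) = F (x - 1 / of_int n, k - 1)" .

  have "right_act n \<theta> F torus_V = (\<lambda>q. \<Sum>j. fps_const ((0 * (1 / ?s)) ^ j / fact j) * (- \<theta>) ^ j *
      coeffwise (\<lambda>g. mult_V n ((partial_s ^^ j) g)) F q)"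
    unfolding right
    by (intro wbz_star_action heis_torus(4) schwartz_mod_mult_V torus_V_mult_wbz_sum
        schwartz_mod_partial_s heis_p_wbz_sum partial_s_cmult assms F)
  hence "right_act n \<theta> F torus_V (x, k) = coeffwise (mult_V n) F (x, k)"
    by (simp add: mult.assoc suminf_power_0 del: of_real_sqrt)
  also have "\<dots> = fps_const ?e * F (x, k)"
    by (rule fps_ext) (simp add: coeffwise_def mult_V_def fcoeff_def)
  finally show "right_act n \<theta> F torus_V (x, k) = fps_const ?e * F (x, k)" .

  \<comment> \<open>The eigenvalue sqrt(2 pi) cancels the 1 / sqrt(2 pi) of \<open>heis_p\<close>,
    leaving the plain Taylor series in - \<theta>.\<close>
  have "right_act n \<theta> F torus_U = (\<lambda>q. \<Sum>j. fps_const ((?s * (1 / ?s)) ^ j / fact j) * (- \<theta>) ^ j *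
      coeffwise (\<lambda>g. shift_U n ((partial_s ^^ j) g)) F q)"
    unfolding right
    by (intro wbz_star_action heis_torus(2) schwartz_mod_shift_U torus_U_mult_wbz_sum
        schwartz_mod_partial_s heis_p_wbz_sum partial_s_cmult assms F)
  moreover have "coeffwise (\<lambda>g. shift_U n ((partial_s ^^ j) g)) F (x, k) =
      coeffwise (vderiv ^^ j) (\<lambda>s. F (s, k - 1)) (x - 1 / of_int n)" for j
    by (rule fps_ext) (simp add: coeffwise_def shift_U_def funpow_partial_s fcoeff_def)
  ultimately show "right_act n \<theta> F torus_U (x, k) =
      formal_shift (- \<theta>) (\<lambda>s. F (s, k - 1)) (x - 1 / of_int n)"
    by (simp add: formal_shift_def)

  have V1: "left_act n \<theta>' torus_V F = (\<lambda>q. \<Sum>j. fps_const (((?s * \<i>) * (?s * of_int n)) ^ j / fact j) * (- \<theta>') ^ j *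
      coeffwise (\<lambda>g. mult_V n ((mult_s ^^ j) g)) F q)"
    unfolding left
    by (intro wbz_star_action heis_torus(3) schwartz_mod_mult_V torus_V_mult_wbz_sum
        schwartz_mod_mult_s heis_q_wbz_sum mult_s_cmult assms F)
  have V2: "coeffwise (\<lambda>g. mult_V n ((mult_s ^^ j) g)) F (x, k) =
      fps_const (of_real x ^ j) * (fps_const ?e * F (x, k))" for j
    by (rule fps_ext) (simp add: coeffwise_def mult_V_def funpow_mult_s fcoeff_def)
  \<comment> \<open>The sign of - \<theta>', the constant sqrt(2 pi)^2 i n = 2 pi i n and the power
    of x from \<open>mult_s\<close> merge into the single base - 2 pi i n x of an exponential series
    in \<theta>'.\<close>
  have V3: "fps_const (((?s * \<i>) * (?s * of_int n)) ^ j / fact j) * (- \<theta>') ^ j * (fps_const (of_real x ^ j) * A) =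
      fps_const ((- 2 * of_real pi * \<i> * of_int n * of_real x) ^ j / fact j) * \<theta>' ^ j * A" for j A
  proof -
    have "- 2 * of_real pi * \<i> * of_int n * of_real x = - 1 * ((?s * \<i>) * (?s * of_int n)) * of_real x"
    proof -
      have "- 2 * of_real pi = - (?s * ?s)" by (simp only: mult_minus_left two_pi_eq)
      moreover have "- (s * s) * \<i> * y * z = - 1 * ((s * \<i>) * (s * y)) * z" for s y z :: complex
        by simp
      ultimately show ?thesis by (simp only:)
    qed
    hence 1: "(- 2 * of_real pi * \<i> * of_int n * of_real x) ^ j =
        (- 1) ^ j * ((?s * \<i>) * (?s * of_int n)) ^ j * of_real x ^ j"
      by (simp only: power_mult_distrib)
    have 2: "(- \<theta>') ^ j = fps_const ((- 1) ^ j) * \<theta>' ^ j"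
    proof -
      have "fps_const ((- 1) ^ j) = (fps_const (- 1)) ^ j" by (rule fps_const_power[symmetric])
      also have "fps_const (- 1) = (- 1 :: complex fps)" using fps_const_neg[of "1::complex"] by simp
      finally show ?thesis by (simp only: power_minus[of \<theta>' j])
    qed
    have 3: "fps_const (a * b * c / d) = fps_const (b / d) * fps_const a * fps_const c" for a b c d :: complex
      by (simp add: mult_ac)
    show ?thesis unfolding 1 2 3 by (simp only: mult_ac)
  qed
  have "left_act n \<theta>' torus_V F (x, k) =
      (\<Sum>j. fps_const ((- 2 * of_real pi * \<i> * of_int n * of_real x) ^ j / fact j) * \<theta>' ^ j * (fps_const ?e * F (x, k)))"
    unfolding V1 V2 V3 ..
  also have "\<dots> = formal_exp (- 2 * of_real pi * \<i> * of_int n * of_real x) \<theta>' * (fps_const ?e * F (x, k))"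
    unfolding formal_exp_eq_suminf[OF assms(3)]
    by (rule fps_suminf_mult) (simp add: Theta_power_nth[OF assms(3)])
  finally show "left_act n \<theta>' torus_V F (x, k) = fps_const ?e *
      formal_exp (- 2 * of_real pi * \<i> * of_int n * of_real x) \<theta>' * F (x, k)"
    by (simp only: mult_ac)
qed

end
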